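(* For $k>2$ and a parameter $m$, let $\mathcal{F}_k\subset J^k(\mathbb{R}^2)$ be the system $\{u_{k-i,i}=\lambda^{im+1}/(im+1):0\le i\le k\}$ (the parameter $\lambda$ being eliminated). For generic $m$, the Lie algebra of contact symmetries of $\mathcal{F}_k$ has dimension $k(k+1)/2+4$, and a basis of it consists of the contact vector fields $X_f$ with generating functions $$f\in\{x^iy^j\ (0\le i+j<k),\ u_x,\ u_y,\ (km+1)u-m\,x\,u_x,\ u+m\,y\,u_y\}.$$
   Context: $J^k(\mathbb{R}^2)$ is the jet space of scalar functions $u(x,y)$ with coordinates $u_{ij}=\partial_x^i\partial_y^ju$. A contact vector field on $J^1(\mathbb{R}^2)$ with generating function $f\in C^\infty(J^1)$ is $X_f=-f_{u_x}D^1_x-f_{u_y}D^1_y+f\,\partial_u+D^1_x(f)\partial_{u_x}+D^1_y(f)\partial_{u_y}$, where $D^1_x=\partial_x+u_x\partial_u$, $D^1_y=\partial_y+u_y\partial_u$. A contact symmetry of a system in $J^k$ is a contact vector field whose prolongation to $J^k$ is tangent to the system. *)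

theory Defs
  imports "HOL-Analysis.Analysis"
begin

text \<open>A point of J^1(R^2) is a tuple (x, y, u, u_x, u_y).\<close>
type_synonym j1pt = "real \<times> real \<times> real \<times> real \<times> real"

fun upd1 :: "nat \<Rightarrow> real \<Rightarrow> j1pt \<Rightarrow> j1pt" where
  "upd1 i t (x, y, u, p, q) =
     (if i = 0 then (t, y, u, p, q) else if i = 1 then (x, t, u, p, q)
      else if i = 2 then (x, y, t, p, q) else if i = 3 then (x, y, u, t, q)
      else (x, y, u, p, t))"

fun coord1 :: "nat \<Rightarrow> j1pt \<Rightarrow> real" where
  "coord1 i (x, y, u, p, q) =
     (if i = 0 then x else if i = 1 then y else if i = 2 then u else if i = 3 then p else q)"

text \<open>C^\<infinity> on R^5: all iterated partial derivatives exist and are continuous,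
  i.e. f lies in a family of continuous functions closed under taking partial derivatives.\<close>
definition smooth_j1 :: "(j1pt \<Rightarrow> real) \<Rightarrow> bool" where
  "smooth_j1 f \<longleftrightarrow>
     (\<exists>S. f \<in> S \<and>
        (\<forall>g\<in>S. continuous_on UNIV g \<and>
           (\<forall>i<5. \<exists>g'\<in>S. \<forall>z. ((\<lambda>t. g (upd1 i t z)) has_real_derivative g' z) (at (coord1 i z)))))"

text \<open>A point of a jet space: (x, y, U) where U i j is the coordinate u_{ij};
  u = U 0 0, u_x = U 1 0, u_y = U 0 1. In J^k only the U i j with i + j \<le> k matter.\<close>
type_synonym jetpt = "real \<times> real \<times> (nat \<Rightarrow> nat \<Rightarrow> real)"

definition jx :: "jetpt \<Rightarrow> real" where "jx P = fst P"
definition jy :: "jetpt \<Rightarrow> real" where "jy P = fst (snd P)"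
definition jU :: "jetpt \<Rightarrow> nat \<Rightarrow> nat \<Rightarrow> real" where "jU P = snd (snd P)"

definition lift1 :: "(j1pt \<Rightarrow> real) \<Rightarrow> jetpt \<Rightarrow> real" where
  "lift1 f P = f (jx P, jy P, jU P 0 0, jU P 1 0, jU P 0 1)"

definition pdx :: "(jetpt \<Rightarrow> real) \<Rightarrow> jetpt \<Rightarrow> real" where
  "pdx F P = deriv (\<lambda>t. F (t, jy P, jU P)) (jx P)"
definition pdy :: "(jetpt \<Rightarrow> real) \<Rightarrow> jetpt \<Rightarrow> real" where
  "pdy F P = deriv (\<lambda>t. F (jx P, t, jU P)) (jy P)"
definition pdU :: "nat \<Rightarrow> nat \<Rightarrow> (jetpt \<Rightarrow> real) \<Rightarrow> jetpt \<Rightarrow> real" where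
  "pdU i j F P = deriv (\<lambda>t. F (jx P, jy P, (jU P)(i := (jU P i)(j := t)))) (jU P i j)"

definition totDx :: "nat \<Rightarrow> (jetpt \<Rightarrow> real) \<Rightarrow> jetpt \<Rightarrow> real" where
  "totDx k F P = pdx F P + (\<Sum>(i, j) \<in> {(i, j). i + j \<le> k}. jU P (Suc i) j * pdU i j F P)"
definition totDy :: "nat \<Rightarrow> (jetpt \<Rightarrow> real) \<Rightarrow> jetpt \<Rightarrow> real" where
  "totDy k F P = pdy F P + (\<Sum>(i, j) \<in> {(i, j). i + j \<le> k}. jU P i (Suc j) * pdU i j F P)"

text \<open>The prolongation to J^k of the contact vector field X_f,
  X_f^(k) = -f_{u_x} D_x - f_{u_y} D_y + \<Sum>_{i+j\<le>k} D_x^i D_y^j(f) \<partial>_{u_{ij}}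
  (D_x, D_y truncated to J^k).  Its components:\<close>
definition prol_x :: "(j1pt \<Rightarrow> real) \<Rightarrow> jetpt \<Rightarrow> real" where
  "prol_x f P = - pdU 1 0 (lift1 f) P"
definition prol_y :: "(j1pt \<Rightarrow> real) \<Rightarrow> jetpt \<Rightarrow> real" where
  "prol_y f P = - pdU 0 1 (lift1 f) P"
definition prol_U :: "nat \<Rightarrow> (j1pt \<Rightarrow> real) \<Rightarrow> nat \<Rightarrow> nat \<Rightarrow> jetpt \<Rightarrow> real" where
  "prol_U k f i j P =
     ((totDx k ^^ i) ((totDy k ^^ j) (lift1 f))) P
     - pdU 1 0 (lift1 f) P * jU P (Suc i) j
     - pdU 0 1 (lift1 f) P * jU P i (Suc j)"

definition tangent_to :: "nat \<Rightarrow> jetpt set \<Rightarrow> jetpt \<Rightarrow> real \<Rightarrow> real \<Rightarrow> (nat \<Rightarrow> nat \<Rightarrow> real) \<Rightarrow> bool" where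
  "tangent_to k S P vx vy V \<longleftrightarrow>
     (\<exists>\<gamma> :: real \<Rightarrow> jetpt. \<exists>e>0. \<gamma> 0 = P \<and> (\<forall>t. \<bar>t\<bar> < e \<longrightarrow> \<gamma> t \<in> S) \<and>
        ((\<lambda>t. jx (\<gamma> t)) has_real_derivative vx) (at 0) \<and>
        ((\<lambda>t. jy (\<gamma> t)) has_real_derivative vy) (at 0) \<and>
        (\<forall>i j. i + j \<le> k \<longrightarrow> ((\<lambda>t. jU (\<gamma> t) i j) has_real_derivative V i j) (at 0)))"

definition contact_symmetry :: "nat \<Rightarrow> jetpt set \<Rightarrow> (j1pt \<Rightarrow> real) \<Rightarrow> bool" where
  "contact_symmetry k S f \<longleftrightarrow>
     smooth_j1 f \<and>
     (\<forall>P\<in>S. tangent_to k S P (prol_x f P) (prol_y f P) (\<lambda>i j. prol_U k f i j P))"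

definition sysF :: "nat \<Rightarrow> real \<Rightarrow> jetpt set" where
  "sysF k m = {P. \<exists>lam>0. \<forall>i\<le>k. jU P (k - i) i = lam powr (real i * m + 1) / (real i * m + 1)}"

definition sym_basis :: "nat \<Rightarrow> real \<Rightarrow> (j1pt \<Rightarrow> real) set" where
  "sym_basis k m =
     {(\<lambda>(x, y, u, p, q). x ^ i * y ^ j) | i j. i + j < k} \<union>
     {(\<lambda>(x, y, u, p, q). p),
      (\<lambda>(x, y, u, p, q). q),
      (\<lambda>(x, y, u, p, q). (real k * m + 1) * u - m * x * p),
      (\<lambda>(x, y, u, p, q). u + m * y * q)}"

end

(* Let f generate a contact symmetry, s = lam^m, and let D_x, D_y be the total derivatives. Tangency to the
   system says that the component of the prolonged field along u_{k-i,i} is s^i times the one along u_{k,0}.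
   For i = 1, at jets whose only nonzero coordinates of order >= k are the prescribed u_{k-i,i}, this reads
   D_x^{k-1} D_y f = s D_x^k f. For k > 2 both sides are affine in the coordinates of order k, with the
   coefficients dictated by the commutators [d/du_{i+1,j}, D_x] = d/du_{i,j}. So the equation is a linear
   relation between the powers of lam with exponents 0, 1, m, m + 1, 2m + 1, which are independent for
   irrational m. It splits into D_y f_p = 0, D_x f_q = 0, D_y f_q - D_x f_p = m (f_u + k D_x f_p), and the
   vanishing of D_x^k f and D_x^{k-1} D_y f at jets of order < k; differentiating the last two by u_{k-1,0}
   makes f affine in u, p, q with coefficients as in the asserted basis. The remaining function of (x, y)
   has vanishing derivatives of order k because of its independence of lam, hence is a polynomial of
   degree < k. The exceptional set of parameters m is the set of rationals. *)

theory Submission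
  imports Defs
begin

section \<open>Partial derivatives on the first jet space\<close>

text \<open>Clairaut's theorem. The second difference of \<open>h\<close> over a small square is
  \<open>e * e\<close> times a value of either mixed partial, by the mean value theorem applied to
  the two variables in either order; continuity then makes the partials agree at the corner.\<close>

lemma mixed_partials_eq:
  fixes h hs ht hst hts :: "real \<Rightarrow> real \<Rightarrow> real"
  assumes hs: "\<And>s t. ((\<lambda>s. h s t) has_real_derivative hs s t) (at s)"
    and ht: "\<And>s t. ((\<lambda>t. h s t) has_real_derivative ht s t) (at t)"
    and hst: "\<And>s t. ((\<lambda>t. hs s t) has_real_derivative hst s t) (at t)"
    and hts: "\<And>s t. ((\<lambda>s. ht s t) has_real_derivative hts s t) (at s)"
    and c1: "continuous_on UNIV (\<lambda>(s, t). hst s t)"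
    and c2: "continuous_on UNIV (\<lambda>(s, t). hts s t)"
  shows "hst a b = hts a b"
proof (rule ccontr)
  assume ne: "hst a b \<noteq> hts a b"
  \<comment> \<open>Half the gap: equal values of the two partials cannot both lie within
    \<open>d\<close> of two numbers \<open>2 * d\<close> apart.\<close>
  define d where "d = \<bar>hst a b - hts a b\<bar> / 2"
  have d: "d > 0" using ne by (simp add: d_def)
  from c1 d obtain d1 where d1: "d1 > 0"
    "\<And>w. dist w (a, b) < d1 \<Longrightarrow> dist ((\<lambda>(s, t). hst s t) w) (hst a b) < d"
    unfolding continuous_on_iff by fastforce
  from c2 d obtain d2 where d2: "d2 > 0"
    "\<And>w. dist w (a, b) < d2 \<Longrightarrow> dist ((\<lambda>(s, t). hts s t) w) (hts a b) < d"
    unfolding continuous_on_iff by fastforce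
  \<comment> \<open>On the open square of side \<open>e\<close> the distance to the corner is
    estimated by the sum of the coordinate distances, hence is below \<open>2 * e\<close>.\<close>
  define e where "e = min d1 d2 / 2"
  have e: "e > 0" "2 * e \<le> d1" "2 * e \<le> d2" using d1 d2 by (auto simp: e_def)
  have near: "dist (\<xi>, \<eta>) (a, b) < 2 * e" if "a < \<xi>" "\<xi> < a + e" "b < \<eta>" "\<eta> < b + e" for \<xi> \<eta>
  proof -
    have "dist (\<xi>, \<eta>) (a, b) \<le> dist \<xi> a + dist \<eta> b"
      by (simp add: dist_Pair_Pair sqrt_sum_squares_le_sum)
    also have "\<dots> < 2 * e" using that by (simp add: dist_real_def)
    finally show ?thesis .
  qed
  have "\<exists>\<xi>. a < \<xi> \<and> \<xi> < a + e \<and>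
      (h (a + e) (b + e) - h (a + e) b) - (h a (b + e) - h a b) = (a + e - a) * (hs \<xi> (b + e) - hs \<xi> b)"
    by (rule MVT2[of a "a + e" "\<lambda>s. h s (b + e) - h s b"]) (use e in \<open>auto intro!: derivative_intros hs\<close>)
  then obtain \<xi> where x: "a < \<xi>" "\<xi> < a + e"
     and x': "(h (a + e) (b + e) - h (a + e) b) - (h a (b + e) - h a b) = e * (hs \<xi> (b + e) - hs \<xi> b)" by auto
  have "\<exists>\<eta>. b < \<eta> \<and> \<eta> < b + e \<and> hs \<xi> (b + e) - hs \<xi> b = (b + e - b) * hst \<xi> \<eta>"
    by (rule MVT2[of b "b + e" "\<lambda>t. hs \<xi> t"]) (use e in \<open>auto intro!: hst\<close>)
  then obtain \<eta> where y: "b < \<eta>" "\<eta> < b + e" "hs \<xi> (b + e) - hs \<xi> b = e * hst \<xi> \<eta>" by auto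
  have "\<exists>\<eta>'. b < \<eta>' \<and> \<eta>' < b + e \<and>
      (h (a + e) (b + e) - h a (b + e)) - (h (a + e) b - h a b) = (b + e - b) * (ht (a + e) \<eta>' - ht a \<eta>')"
    by (rule MVT2[of b "b + e" "\<lambda>t. h (a + e) t - h a t"]) (use e in \<open>auto intro!: derivative_intros ht\<close>)
  then obtain \<eta>' where y2: "b < \<eta>'" "\<eta>' < b + e"
     and y2': "(h (a + e) (b + e) - h a (b + e)) - (h (a + e) b - h a b) = e * (ht (a + e) \<eta>' - ht a \<eta>')" by auto
  have "\<exists>\<xi>'. a < \<xi>' \<and> \<xi>' < a + e \<and> ht (a + e) \<eta>' - ht a \<eta>' = (a + e - a) * hts \<xi>' \<eta>'"
    by (rule MVT2[of a "a + e" "\<lambda>s. ht s \<eta>'"]) (use e in \<open>auto intro!: hts\<close>)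
  then obtain \<xi>' where x2: "a < \<xi>'" "\<xi>' < a + e" "ht (a + e) \<eta>' - ht a \<eta>' = e * hts \<xi>' \<eta>'" by auto
  have "e * (e * hst \<xi> \<eta>) = e * (e * hts \<xi>' \<eta>')"
    using x' y(3) y2' x2(3) by (simp add: algebra_simps)
  then have eq: "hst \<xi> \<eta> = hts \<xi>' \<eta>'" using e by simp
  have "dist (hst \<xi> \<eta>) (hst a b) < d"
    using d1(2)[of "(\<xi>, \<eta>)"] near[OF x y(1,2)] e by simp
  moreover have "dist (hts \<xi>' \<eta>') (hts a b) < d"
    using d2(2)[of "(\<xi>', \<eta>')"] near[OF x2(1,2) y2(1,2)] e by simp
  ultimately show False
    using eq by (simp add: d_def dist_real_def abs_if split: if_splits)
qed

definition pd1 :: "nat \<Rightarrow> (j1pt \<Rightarrow> real) \<Rightarrow> j1pt \<Rightarrow> real" where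
  "pd1 i g z = deriv (\<lambda>t. g (upd1 i t z)) (coord1 i z)"

text \<open>By uniqueness of derivatives \<open>pd1 i g\<close> is a member of the family witnessing
  smoothness of \<open>g\<close>, so the same family witnesses its own smoothness.\<close>

lemma smooth_pd1:
  assumes "smooth_j1 g" "i < 5"
  shows has_derivative_pd1: "((\<lambda>t. g (upd1 i t z)) has_real_derivative pd1 i g z) (at (coord1 i z))"
    and smooth_j1_pd1: "smooth_j1 (pd1 i g)"
proof -
  obtain S where S: "g \<in> S" "\<And>g. g \<in> S \<Longrightarrow> continuous_on UNIV g"
    "\<And>g i. g \<in> S \<Longrightarrow> i < 5 \<Longrightarrow> \<exists>g'\<in>S. \<forall>z. ((\<lambda>t. g (upd1 i t z)) has_real_derivative g' z) (at (coord1 i z))"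
    using assms(1) unfolding smooth_j1_def by blast
  obtain g' where g': "g' \<in> S" "\<And>z. ((\<lambda>t. g (upd1 i t z)) has_real_derivative g' z) (at (coord1 i z))"
    using S(3)[OF S(1) assms(2)] by blast
  have eq: "pd1 i g = g'"
    unfolding pd1_def using g'(2) by (auto intro!: DERIV_imp_deriv)
  show "((\<lambda>t. g (upd1 i t z)) has_real_derivative pd1 i g z) (at (coord1 i z))"
    using g'(2) eq by simp
  show "smooth_j1 (pd1 i g)"
    unfolding smooth_j1_def eq using S g'(1) by blast
qed

lemma smooth_j1_continuous: "smooth_j1 g \<Longrightarrow> continuous_on UNIV g"
  unfolding smooth_j1_def by blast

lemma coord1_upd1_same: "i < 5 \<Longrightarrow> coord1 i (upd1 i t z) = t"
  by (cases z) auto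

lemma upd1_upd1_same: "i < 5 \<Longrightarrow> upd1 i s (upd1 i t z) = upd1 i s z"
  by (cases z) auto

lemma upd1_commute: "i < 5 \<Longrightarrow> j < 5 \<Longrightarrow> i \<noteq> j \<Longrightarrow> upd1 i s (upd1 j t z) = upd1 j t (upd1 i s z)"
  by (cases z) auto

lemma upd1_coord1: "i < 5 \<Longrightarrow> upd1 i (coord1 i z) z = z"
  by (cases z) auto

lemma continuous_on_upd1_upd1: "continuous_on UNIV (\<lambda>(s, t). upd1 i s (upd1 j t z))"
proof -
  obtain x y u p q where z: "z = (x, y, u, p, q)" by (cases z)
  have upd: "upd1 i t (x, y, u, p, q) = (if i = 0 then t else x, if i = 1 then t else y,
     if i = 2 then t else u, if i = 3 then t else p, if i > 3 then t else q)" for i t x y u p q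
    by auto
  have "continuous_on UNIV (\<lambda>w :: real \<times> real. if A then fst w else if B then snd w else c)" for A B and c :: real
    by (cases A; cases B; auto intro!: continuous_intros)
  then show ?thesis
    unfolding z upd case_prod_beta by (intro continuous_on_Pair)
qed

lemma has_derivative_pd1_line:
  assumes "smooth_j1 g" "i < 5"
  shows "((\<lambda>t. g (upd1 i t z)) has_real_derivative pd1 i g (upd1 i t z)) (at t)"
  using has_derivative_pd1[OF assms, of "upd1 i t z"] assms(2)
  by (simp add: coord1_upd1_same upd1_upd1_same)

lemma pd1_commute:
  assumes g: "smooth_j1 g" and ij: "i < 5" "j < 5"
  shows "pd1 i (pd1 j g) = pd1 j (pd1 i g)"
proof (cases "i = j")
  case False
  show ?thesis
  proof
    fix z
    let ?w = "\<lambda>s t. upd1 i s (upd1 j t z)"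
    have w: "?w s t = upd1 j t (upd1 i s z)" for s t using upd1_commute[OF ij False] .
    have "pd1 j (pd1 i g) (?w (coord1 i z) (coord1 j z)) = pd1 i (pd1 j g) (?w (coord1 i z) (coord1 j z))"
    proof (rule mixed_partials_eq[of "\<lambda>s t. g (?w s t)" "\<lambda>s t. pd1 i g (?w s t)" "\<lambda>s t. pd1 j g (?w s t)"
        "\<lambda>s t. pd1 j (pd1 i g) (?w s t)" "\<lambda>s t. pd1 i (pd1 j g) (?w s t)"])
      fix s t
      show "((\<lambda>s. g (?w s t)) has_real_derivative pd1 i g (?w s t)) (at s)"
        by (rule has_derivative_pd1_line[OF g ij(1)])
      show "((\<lambda>s. pd1 j g (?w s t)) has_real_derivative pd1 i (pd1 j g) (?w s t)) (at s)"
        by (rule has_derivative_pd1_line[OF smooth_j1_pd1[OF g ij(2)] ij(1)])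
      show "((\<lambda>t. g (?w s t)) has_real_derivative pd1 j g (?w s t)) (at t)"
        unfolding w by (rule has_derivative_pd1_line[OF g ij(2)])
      show "((\<lambda>t. pd1 i g (?w s t)) has_real_derivative pd1 j (pd1 i g) (?w s t)) (at t)"
        unfolding w by (rule has_derivative_pd1_line[OF smooth_j1_pd1[OF g ij(1)] ij(2)])
    next
      have "continuous_on UNIV (\<lambda>w. pd1 i (pd1 j g) ((\<lambda>(s, t). ?w s t) w))"
        "continuous_on UNIV (\<lambda>w. pd1 j (pd1 i g) ((\<lambda>(s, t). ?w s t) w))"
        using g ij by (auto intro!: continuous_on_compose2[OF smooth_j1_continuous continuous_on_upd1_upd1]
          smooth_j1_pd1)
      then show "continuous_on UNIV (\<lambda>(s, t). pd1 j (pd1 i g) (?w s t))"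
        "continuous_on UNIV (\<lambda>(s, t). pd1 i (pd1 j g) (?w s t))"
        by (simp_all add: case_prod_beta)
    qed
    then show "pd1 i (pd1 j g) z = pd1 j (pd1 i g) z"
      using ij by (simp add: upd1_coord1)
  qed
qed simp

section \<open>Polynomial differential functions on jet space\<close>

text \<open>One type of coordinate directions makes \<open>pdx\<close>, \<open>pdy\<close> and
  \<open>pdU\<close> instances of a single operator \<open>pdd\<close>, so that rules are proved
  once.\<close>

datatype dir = DX | DY | DU nat nat

fun jupd :: "dir \<Rightarrow> real \<Rightarrow> jetpt \<Rightarrow> jetpt" where
  "jupd DX t P = (t, jy P, jU P)"
| "jupd DY t P = (jx P, t, jU P)"
| "jupd (DU i j) t P = (jx P, jy P, (jU P)(i := (jU P i)(j := t)))"

fun jget :: "dir \<Rightarrow> jetpt \<Rightarrow> real" where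
  "jget DX P = jx P"
| "jget DY P = jy P"
| "jget (DU i j) P = jU P i j"

definition pdd :: "dir \<Rightarrow> (jetpt \<Rightarrow> real) \<Rightarrow> jetpt \<Rightarrow> real" where
  "pdd d F P = deriv (\<lambda>t. F (jupd d t P)) (jget d P)"

lemma jet_sel [simp]: "jx (x, y, V) = x" "jy (x, y, V) = y" "jU (x, y, V) = V"
  by (simp_all add: jx_def jy_def jU_def)

lemma jet_eqI: "jx P = jx Q \<Longrightarrow> jy P = jy Q \<Longrightarrow> (\<And>i j. jU P i j = jU Q i j) \<Longrightarrow> P = Q"
  by (auto simp: jx_def jy_def jU_def prod_eq_iff)

lemma pdx_eq: "pdx = pdd DX" and pdy_eq: "pdy = pdd DY" and pdU_eq: "pdU i j = pdd (DU i j)"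
  by (auto simp: fun_eq_iff pdx_def pdy_def pdU_def pdd_def)

lemma jupd_jupd [simp]: "jupd d s (jupd d t P) = jupd d s P"
  by (cases d) auto

lemma jget_jupd [simp]: "jget d (jupd d t P) = t"
  by (cases d) auto

lemma jupd_jget [simp]: "jupd d (jget d P) P = P"
  by (cases d) (auto intro!: jet_eqI)

lemma jU_jupd: "jU (jupd d t P) i j = (if d = DU i j then t else jU P i j)"
  by (cases d) auto

definition proj1 :: "jetpt \<Rightarrow> j1pt" where
  "proj1 P = (jx P, jy P, jU P 0 0, jU P 1 0, jU P 0 1)"

lemma lift1_eq: "lift1 g P = g (proj1 P)"
  by (simp add: lift1_def proj1_def)

text \<open>The value 5 marks the directions on which functions lifted from the first jet space do
  not depend.\<close>

fun dix :: "dir \<Rightarrow> nat" where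
  "dix DX = 0"
| "dix DY = 1"
| "dix (DU i j) = (if i = 0 \<and> j = 0 then 2 else if i = 1 \<and> j = 0 then 3 else if i = 0 \<and> j = 1 then 4 else 5)"

lemma proj1_jupd: "proj1 (jupd d t P) = (if dix d < 5 then upd1 (dix d) t (proj1 P) else proj1 P)"
  by (cases d) (auto simp: proj1_def)

lemma jget_proj1: "dix d < 5 \<Longrightarrow> jget d P = coord1 (dix d) (proj1 P)"
  by (cases d) (auto simp: proj1_def split: if_splits)

text \<open>Polynomials in the jet coordinates with smooth coefficients pulled back from the first
  jet space. The class contains \<open>lift1 f\<close>, is closed under partial and total
  derivatives, and makes every \<open>deriv\<close> in their definitions a genuine
  derivative.\<close>

inductive jetpoly :: "(jetpt \<Rightarrow> real) \<Rightarrow> bool" where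
  jetpoly_lift1: "smooth_j1 g \<Longrightarrow> jetpoly (lift1 g)"
| jetpoly_const: "jetpoly (\<lambda>P. c)"
| jetpoly_coord: "jetpoly (\<lambda>P. jU P i j)"
| jetpoly_add: "jetpoly F \<Longrightarrow> jetpoly G \<Longrightarrow> jetpoly (\<lambda>P. F P + G P)"
| jetpoly_mult: "jetpoly F \<Longrightarrow> jetpoly G \<Longrightarrow> jetpoly (\<lambda>P. F P * G P)"

lemma pdd_lift1:
  assumes "smooth_j1 g"
  shows "pdd d (lift1 g) = (if dix d < 5 then lift1 (pd1 (dix d) g) else (\<lambda>P. 0))"
proof (cases "dix d < 5")
  case True
  then show ?thesis
    by (simp add: fun_eq_iff pdd_def lift1_eq proj1_jupd jget_proj1 pd1_def)
next
  case False
  then show ?thesis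
    by (simp add: fun_eq_iff pdd_def lift1_eq proj1_jupd)
qed

lemma pdd_const [simp]: "pdd d (\<lambda>P. c) = (\<lambda>P. 0)"
  by (simp add: fun_eq_iff pdd_def)

lemma pdd_coord: "pdd d (\<lambda>P. jU P i j) = (\<lambda>P. if d = DU i j then 1 else 0)"
  by (auto simp: fun_eq_iff pdd_def jU_jupd)

lemma jetpoly_has_derivative:
  assumes "jetpoly F"
  shows "((\<lambda>t. F (jupd d t P)) has_real_derivative pdd d F P) (at (jget d P))"
proof -
  have "(\<lambda>t. F (jupd d t P)) field_differentiable (at (jget d P))"
    using assms
  proof induction
    case (jetpoly_lift1 g)
    show ?case
    proof (cases "dix d < 5")
      case True
      then show ?thesis
        using has_derivative_pd1[OF jetpoly_lift1 True, of "proj1 P"]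
        by (auto simp: lift1_eq proj1_jupd jget_proj1 field_differentiable_def)
    qed (simp add: lift1_eq proj1_jupd)
  next
    case (jetpoly_coord i j)
    then show ?case by (cases "d = DU i j") (auto simp: jU_jupd intro!: derivative_intros)
  qed (auto intro!: derivative_intros)
  then show ?thesis
    unfolding pdd_def by (simp add: DERIV_deriv_iff_field_differentiable)
qed

lemma jetpoly_has_derivative_line:
  assumes "jetpoly F"
  shows "((\<lambda>t. F (jupd d t P)) has_real_derivative pdd d F (jupd d t P)) (at t)"
  using jetpoly_has_derivative[OF assms, of d "jupd d t P"] by simp

lemma pdd_add: "jetpoly F \<Longrightarrow> jetpoly G \<Longrightarrow> pdd d (\<lambda>P. F P + G P) = (\<lambda>P. pdd d F P + pdd d G P)"
  by (rule ext, subst pdd_def, rule DERIV_imp_deriv)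
    (auto intro!: derivative_eq_intros jetpoly_has_derivative)

lemma pdd_mult:
  "jetpoly F \<Longrightarrow> jetpoly G \<Longrightarrow> pdd d (\<lambda>P. F P * G P) = (\<lambda>P. pdd d F P * G P + F P * pdd d G P)"
  by (rule ext, subst pdd_def, rule DERIV_imp_deriv)
    (auto intro!: derivative_eq_intros jetpoly_has_derivative simp: algebra_simps)

lemma jetpoly_pdd: "jetpoly F \<Longrightarrow> jetpoly (pdd d F)"
  by (induction rule: jetpoly.induct)
    (auto simp: pdd_lift1 pdd_coord pdd_add pdd_mult intro!: jetpoly.intros smooth_j1_pd1)

text \<open>On lifted functions this is \<open>pd1_commute\<close>; the sum and product rules carry
  it to the whole class.\<close>

lemma pdd_commute: "jetpoly F \<Longrightarrow> pdd d (pdd d' F) = pdd d' (pdd d F)"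
proof (induction rule: jetpoly.induct)
  case (jetpoly_lift1 g)
  then show ?case by (auto simp: pdd_lift1 smooth_j1_pd1 pd1_commute)
next
  case (jetpoly_mult F G)
  then show ?case
    by (simp add: pdd_mult pdd_add jetpoly_pdd jetpoly.intros fun_eq_iff algebra_simps)
qed (auto simp: pdd_coord pdd_add jetpoly_pdd)

lemma jetpoly_sum: "finite T \<Longrightarrow> (\<And>x. x \<in> T \<Longrightarrow> jetpoly (F x)) \<Longrightarrow> jetpoly (\<lambda>P. \<Sum>x\<in>T. F x P)"
  by (induction rule: finite_induct) (auto intro!: jetpoly.intros)

lemma pdd_sum:
  "finite T \<Longrightarrow> (\<And>x. x \<in> T \<Longrightarrow> jetpoly (F x)) \<Longrightarrow> pdd d (\<lambda>P. \<Sum>x\<in>T. F x P) = (\<lambda>P. \<Sum>x\<in>T. pdd d (F x) P)"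
  by (induction rule: finite_induct) (auto simp: pdd_add jetpoly_sum)

lemma finite_order_le: "finite {(i, j). i + j \<le> (k :: nat)}"
  by (rule finite_subset[of _ "{..k} \<times> {..k}"]) auto

lemma totDx_eq: "totDx k F = (\<lambda>P. pdd DX F P + (\<Sum>c\<in>{(i, j). i + j \<le> k}. jU P (Suc (fst c)) (snd c) * pdd (DU (fst c) (snd c)) F P))"
  by (simp add: fun_eq_iff totDx_def pdx_eq pdU_eq case_prod_beta)

lemma totDy_eq: "totDy k F = (\<lambda>P. pdd DY F P + (\<Sum>c\<in>{(i, j). i + j \<le> k}. jU P (fst c) (Suc (snd c)) * pdd (DU (fst c) (snd c)) F P))"
  by (simp add: fun_eq_iff totDy_def pdy_eq pdU_eq case_prod_beta)

lemma jetpoly_totDx: "jetpoly F \<Longrightarrow> jetpoly (totDx k F)"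
  unfolding totDx_eq by (intro jetpoly.intros jetpoly_sum finite_order_le jetpoly_pdd)

lemma jetpoly_totDy: "jetpoly F \<Longrightarrow> jetpoly (totDy k F)"
  unfolding totDy_eq by (intro jetpoly.intros jetpoly_sum finite_order_le jetpoly_pdd)

lemma jetpoly_totDx_pow: "jetpoly F \<Longrightarrow> jetpoly ((totDx k ^^ n) F)"
  by (induction n) (auto intro: jetpoly_totDx)

lemma totDx_const [simp]: "totDx k (\<lambda>P. c) = (\<lambda>P. 0)"
  by (simp add: totDx_eq)

lemma totDx_add: "jetpoly F \<Longrightarrow> jetpoly G \<Longrightarrow> totDx k (\<lambda>P. F P + G P) = (\<lambda>P. totDx k F P + totDx k G P)"
  by (simp add: totDx_eq pdd_add algebra_simps sum.distrib)

lemma totDx_cmult: "jetpoly F \<Longrightarrow> totDx k (\<lambda>P. c * F P) = (\<lambda>P. c * totDx k F P)"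
  by (simp add: totDx_eq pdd_mult jetpoly.intros algebra_simps sum_distrib_left)

text \<open>The commutators of the total derivatives with the coordinate derivatives; the bound
  \<open>i + j \<le> k\<close> is where the truncation of the total derivatives to order \<open>k\<close> is felt.\<close>

lemma pdd_totDx:
  assumes F: "jetpoly F"
  shows "pdd d (totDx k F) P = totDx k (pdd d F) P +
    (case d of DU (Suc i) j \<Rightarrow> if i + j \<le> k then pdd (DU i j) F P else 0 | _ \<Rightarrow> 0)"
proof -
  let ?T = "{(i, j). i + j \<le> k}"
  have nice: "jetpoly (\<lambda>P. jU P (Suc (fst c)) (snd c) * pdd (DU (fst c) (snd c)) F P)" for c
    by (intro jetpoly.intros jetpoly_pdd F)
  have "pdd d (totDx k F) P = pdd d (pdd DX F) P
     + (\<Sum>c\<in>?T. (if d = DU (Suc (fst c)) (snd c) then 1 else 0) * pdd (DU (fst c) (snd c)) F P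
          + jU P (Suc (fst c)) (snd c) * pdd d (pdd (DU (fst c) (snd c)) F) P)"
    unfolding totDx_eq
    by (simp add: pdd_add pdd_sum pdd_mult pdd_coord finite_order_le nice jetpoly_sum jetpoly_pdd F jetpoly.intros
        del: mult.commute cong: if_cong)
  \<comment> \<open>Besides \<open>totDx k (pdd d F)\<close> there remain the terms where
    \<open>d\<close> hits a coefficient \<open>jU P (Suc i) j\<close>, and \<open>d\<close> can be
    at most one of these coordinates.\<close>
  also have "\<dots> = totDx k (pdd d F) P
     + (\<Sum>c\<in>?T. (if d = DU (Suc (fst c)) (snd c) then 1 else 0) * pdd (DU (fst c) (snd c)) F P)"
    unfolding totDx_eq by (simp add: sum.distrib pdd_commute[OF F, of d])
  also have "(\<Sum>c\<in>?T. (if d = DU (Suc (fst c)) (snd c) then 1 else 0) * pdd (DU (fst c) (snd c)) F P)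
     = (case d of DU (Suc i) j \<Rightarrow> if i + j \<le> k then pdd (DU i j) F P else 0 | _ \<Rightarrow> 0)"
  proof (cases "\<exists>i j. d = DU (Suc i) j")
    case True
    then obtain i j where d: "d = DU (Suc i) j" by blast
    have "(\<Sum>c\<in>?T. (if d = DU (Suc (fst c)) (snd c) then 1 else 0) * pdd (DU (fst c) (snd c)) F P)
      = (\<Sum>c\<in>?T. if c = (i, j) then pdd (DU i j) F P else 0)"
      by (rule sum.cong) (auto simp: d)
    then show ?thesis by (simp add: d sum.delta finite_order_le)
  qed (auto intro!: sum.neutral split: dir.splits nat.splits)
  finally show ?thesis .
qed

lemma pdd_totDy:
  assumes F: "jetpoly F"
  shows "pdd d (totDy k F) P = totDy k (pdd d F) P +
    (case d of DU i (Suc j) \<Rightarrow> if i + j \<le> k then pdd (DU i j) F P else 0 | _ \<Rightarrow> 0)"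
proof -
  let ?T = "{(i, j). i + j \<le> k}"
  have nice: "jetpoly (\<lambda>P. jU P (fst c) (Suc (snd c)) * pdd (DU (fst c) (snd c)) F P)" for c
    by (intro jetpoly.intros jetpoly_pdd F)
  have "pdd d (totDy k F) P = pdd d (pdd DY F) P
     + (\<Sum>c\<in>?T. (if d = DU (fst c) (Suc (snd c)) then 1 else 0) * pdd (DU (fst c) (snd c)) F P
          + jU P (fst c) (Suc (snd c)) * pdd d (pdd (DU (fst c) (snd c)) F) P)"
    unfolding totDy_eq
    by (simp add: pdd_add pdd_sum pdd_mult pdd_coord finite_order_le nice jetpoly_sum jetpoly_pdd F jetpoly.intros
        del: mult.commute cong: if_cong)
  also have "\<dots> = totDy k (pdd d F) P
     + (\<Sum>c\<in>?T. (if d = DU (fst c) (Suc (snd c)) then 1 else 0) * pdd (DU (fst c) (snd c)) F P)"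
    unfolding totDy_eq by (simp add: sum.distrib pdd_commute[OF F, of d])
  also have "(\<Sum>c\<in>?T. (if d = DU (fst c) (Suc (snd c)) then 1 else 0) * pdd (DU (fst c) (snd c)) F P)
     = (case d of DU i (Suc j) \<Rightarrow> if i + j \<le> k then pdd (DU i j) F P else 0 | _ \<Rightarrow> 0)"
  proof (cases "\<exists>i j. d = DU i (Suc j)")
    case True
    then obtain i j where d: "d = DU i (Suc j)" by blast
    have "(\<Sum>c\<in>?T. (if d = DU (fst c) (Suc (snd c)) then 1 else 0) * pdd (DU (fst c) (snd c)) F P)
      = (\<Sum>c\<in>?T. if c = (i, j) then pdd (DU i j) F P else 0)"
      by (rule sum.cong) (auto simp: d)
    then show ?thesis by (simp add: d sum.delta finite_order_le)
  qed (auto intro!: sum.neutral split: dir.splits nat.splits)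
  finally show ?thesis .
qed

section \<open>Iterated total derivatives\<close>

text \<open>Commuting with \<open>totDx\<close> lowers the first index and keeps the second index
  \<open>b\<close>, so vanishing for all first indices is inherited by every power.\<close>

lemma pdd_totDx_pow_zero:
  assumes G: "jetpoly G" and z: "\<And>j. pdd (DU j b) G = (\<lambda>P. 0)"
  shows "pdd (DU j b) ((totDx k ^^ n) G) = (\<lambda>P. 0)"
proof (induction n arbitrary: j)
  case (Suc n)
  have "jetpoly ((totDx k ^^ n) G)" by (rule jetpoly_totDx_pow[OF G])
  then show ?case by (auto simp: fun_eq_iff pdd_totDx Suc split: nat.splits)
qed (simp add: z)

text \<open>The three leading coefficients in the formula
  \<open>\<partial>\<^sub>j (D\<^sub>x)^n = \<Sum>l. binom(n, l) (D\<^sub>x)^(n - l) \<partial>\<^sub>(j - l)\<close>.\<close>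

lemma pdd_totDx_pow:
  assumes G: "jetpoly G" and z: "\<And>j. j \<ge> 2 \<Longrightarrow> pdd (DU j b) G = (\<lambda>P. 0)"
  defines "g0 \<equiv> pdd (DU 0 b) G" and "g1 \<equiv> pdd (DU 1 b) G"
  assumes "j + b \<le> Suc k" "n \<le> Suc j"
  shows "pdd (DU j b) ((totDx k ^^ n) G) =
    (\<lambda>P. if j \<ge> n + 2 then 0 else if j = n + 1 then g1 P else if j = n then g0 P + real n * totDx k g1 P
         else real n * totDx k g0 P + real n * (real n - 1) / 2 * totDx k (totDx k g1) P)"
  using assms(5,6)
proof (induction n arbitrary: j)
  case 0
  consider "j = 0" | "j = 1" | "j \<ge> 2" by linarith
  then show ?case by cases (auto simp: g0_def g1_def z)
next
  case (Suc n)
  define H where "H = (totDx k ^^ n) G"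
  have H: "jetpoly H" unfolding H_def by (rule jetpoly_totDx_pow[OF G])
  have g: "jetpoly g0" "jetpoly g1" unfolding g0_def g1_def by (simp_all add: jetpoly_pdd G)
  have IH: "pdd (DU j b) H = (\<lambda>P. if j \<ge> n + 2 then 0 else if j = n + 1 then g1 P
      else if j = n then g0 P + real n * totDx k g1 P
      else real n * totDx k g0 P + real n * (real n - 1) / 2 * totDx k (totDx k g1) P)"
    if "j + b \<le> Suc k" "n \<le> Suc j" for j
    unfolding H_def by (rule Suc.IH[OF that])
  show ?case
  proof (cases j)
    case 0
    then have n: "n = 0" using Suc.prems by simp
    show ?thesis by (rule ext) (simp add: n 0 g0_def pdd_totDx G)
  next
    case j: (Suc i)
    have i: "i + b \<le> k" "n \<le> Suc i" using Suc.prems j by auto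
    have step: "pdd (DU j b) (totDx k H) = (\<lambda>P. totDx k (pdd (DU j b) H) P + pdd (DU i b) H P)"
      by (simp add: fun_eq_iff pdd_totDx H j i)
    have *: "totDx k (\<lambda>P. g0 P + real n * totDx k g1 P) = (\<lambda>P. totDx k g0 P + real n * totDx k (totDx k g1) P)"
      using g by (simp add: totDx_add totDx_cmult jetpoly.intros jetpoly_totDx)
    have IHi: "pdd (DU i b) H = (\<lambda>P. if i \<ge> n + 2 then 0 else if i = n + 1 then g1 P
      else if i = n then g0 P + real n * totDx k g1 P
      else real n * totDx k g0 P + real n * (real n - 1) / 2 * totDx k (totDx k g1) P)"
      by (rule IH) (use i in auto)
    have IHj: "pdd (DU j b) H = (\<lambda>P. if j \<ge> n + 2 then 0 else if j = n + 1 then g1 P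
      else g0 P + real n * totDx k g1 P)"
      using IH[of j] Suc.prems by (auto simp: fun_eq_iff)
    consider "j \<ge> n + 3" | "j = n + 2" | "j = n + 1" | "j = n" using Suc.prems by linarith
    then have "pdd (DU j b) (totDx k H) =
      (\<lambda>P. if j \<ge> Suc n + 2 then 0 else if j = Suc n + 1 then g1 P else if j = Suc n then g0 P + real (Suc n) * totDx k g1 P
         else real (Suc n) * totDx k g0 P + real (Suc n) * (real (Suc n) - 1) / 2 * totDx k (totDx k g1) P)"
    proof cases
      \<comment> \<open>The last branch only occurs for an exponent one above the index. Here
        Pascal's rule adds the coefficients: \<open>n\<close> and \<open>n * (n - 1) / 2\<close>
        give \<open>(n + 1) * n / 2\<close>.\<close>
      case 4
      then have "i + 1 = n" using j by simp
      then show ?thesis unfolding step IHi IHj using 4 j *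
        by (auto simp: fun_eq_iff field_simps)
    qed (unfold step IHi IHj, use j in \<open>auto simp: fun_eq_iff algebra_simps\<close>)
    then show ?thesis by (simp add: H_def)
  qed
qed

lemma pdd_totDx_pow_leading:
  assumes G: "jetpoly G" and z: "\<And>j. j \<ge> 2 \<Longrightarrow> pdd (DU j b) G = (\<lambda>P. 0)"
  shows pdd_totDx_pow_Suc: "n + b \<le> k \<Longrightarrow> pdd (DU (Suc n) b) ((totDx k ^^ n) G) = pdd (DU 1 b) G"
    and pdd_totDx_pow_same: "n + b \<le> Suc k \<Longrightarrow> pdd (DU n b) ((totDx k ^^ n) G) =
      (\<lambda>P. pdd (DU 0 b) G P + real n * totDx k (pdd (DU 1 b) G) P)"
    and pdd_totDx_pow_pred: "n + b \<le> Suc k \<Longrightarrow> pdd (DU n b) ((totDx k ^^ Suc n) G) =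
      (\<lambda>P. (real n + 1) * totDx k (pdd (DU 0 b) G) P
         + (real n + 1) * real n / 2 * totDx k (totDx k (pdd (DU 1 b) G)) P)"
  using pdd_totDx_pow[OF G z, where j = "Suc n" and n = n and k = k]
    pdd_totDx_pow[OF G z, where j = n and n = n and k = k]
    pdd_totDx_pow[OF G z, where j = n and n = "Suc n" and k = k]
  by (simp_all add: algebra_simps del: funpow.simps)

lemma totDx_lift1:
  assumes g: "smooth_j1 g" and k: "k \<ge> 1"
  shows "totDx k (lift1 g) P = lift1 (pd1 0 g) P + jU P 1 0 * lift1 (pd1 2 g) P
    + jU P 2 0 * lift1 (pd1 3 g) P + jU P 1 1 * lift1 (pd1 4 g) P"
proof -
  have "(\<Sum>c\<in>{(i, j). i + j \<le> k}. jU P (Suc (fst c)) (snd c) * pdd (DU (fst c) (snd c)) (lift1 g) P)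
     = (\<Sum>c\<in>{(0, 0), (1, 0), (0, 1)}. jU P (Suc (fst c)) (snd c) * pdd (DU (fst c) (snd c)) (lift1 g) P)"
    using k by (intro sum.mono_neutral_right finite_order_le) (auto simp: pdd_lift1 g)
  then show ?thesis
    by (simp add: totDx_eq pdd_lift1 g numeral_2_eq_2)
qed

lemma totDy_lift1:
  assumes g: "smooth_j1 g" and k: "k \<ge> 1"
  shows "totDy k (lift1 g) P = lift1 (pd1 1 g) P + jU P 0 1 * lift1 (pd1 2 g) P
    + jU P 1 1 * lift1 (pd1 3 g) P + jU P 0 2 * lift1 (pd1 4 g) P"
proof -
  have "(\<Sum>c\<in>{(i, j). i + j \<le> k}. jU P (fst c) (Suc (snd c)) * pdd (DU (fst c) (snd c)) (lift1 g) P)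
     = (\<Sum>c\<in>{(0, 0), (1, 0), (0, 1)}. jU P (fst c) (Suc (snd c)) * pdd (DU (fst c) (snd c)) (lift1 g) P)"
    using k by (intro sum.mono_neutral_right finite_order_le) (auto simp: pdd_lift1 g)
  then show ?thesis
    by (simp add: totDy_eq pdd_lift1 g numeral_2_eq_2)
qed

section \<open>Dependence on the coordinates of order k\<close>

text \<open>The coordinates of order \<open>k\<close> are filled in one after the other:
  \<open>n = 0\<close> leaves the jet unchanged and \<open>n = Suc k\<close> prescribes all of them.
  The intermediate values serve the induction below.\<close>

definition top_jet :: "nat \<Rightarrow> (nat \<Rightarrow> real) \<Rightarrow> nat \<Rightarrow> jetpt \<Rightarrow> jetpt" where
  "top_jet k c n P = (jx P, jy P, \<lambda>i j. if i + j = k \<and> j < n then c j else jU P i j)"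

text \<open>The derivatives in the top coordinates depend only on lower order, so \<open>F\<close>
  is affine along each top direction with a slope unaffected by the top coordinates already switched
  on.\<close>

lemma top_jet_affine:
  assumes F: "jetpoly F" and low: "\<And>i j. i + j = k \<Longrightarrow> jU P i j = 0"
    and dep: "\<And>i Q. i \<le> k \<Longrightarrow> jx Q = jx P \<Longrightarrow> jy Q = jy P \<Longrightarrow> (\<And>a b. a + b < k \<Longrightarrow> jU Q a b = jU P a b)
       \<Longrightarrow> pdd (DU (k - i) i) F Q = pdd (DU (k - i) i) F P"
  shows "n \<le> Suc k \<Longrightarrow> F (top_jet k c n P) = F P + (\<Sum>i<n. c i * pdd (DU (k - i) i) F P)"
proof (induction n)
  case 0
  have "top_jet k c 0 P = P" by (auto simp: top_jet_def intro!: jet_eqI)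
  then show ?case by simp
next
  case (Suc n)
  let ?d = "DU (k - n) n" and ?Q = "top_jet k c n P"
  have der: "((\<lambda>t. F (jupd ?d t ?Q)) has_real_derivative pdd ?d F P) (at t)" for t
  proof -
    have "pdd ?d F (jupd ?d t ?Q) = pdd ?d F P"
      using Suc.prems by (intro dep) (auto simp: top_jet_def)
    then show ?thesis using jetpoly_has_derivative_line[OF F, of ?d ?Q t] by metis
  qed
  \<comment> \<open>With its linear part removed the function is constant; its values at
    \<open>c n\<close> and at 0, the coordinate of \<open>?Q\<close>, are compared.\<close>
  have "((\<lambda>t. F (jupd ?d t ?Q) - t * pdd ?d F P) has_real_derivative 0) (at t)" for t
    using DERIV_diff[OF der[of t] DERIV_cmult_right[OF DERIV_ident, of "pdd ?d F P"]] by (simp del: jupd.simps)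
  then have "F (jupd ?d (c n) ?Q) - c n * pdd ?d F P = F (jupd ?d 0 ?Q) - 0 * pdd ?d F P"
    using DERIV_isconst_all by blast
  moreover have "jupd ?d (c n) ?Q = top_jet k c (Suc n) P"
  proof (rule jet_eqI)
    show "jU (jupd ?d (c n) ?Q) i j = jU (top_jet k c (Suc n) P) i j" for i j
      using Suc.prems by (auto simp: jU_jupd top_jet_def less_Suc_eq simp del: jupd.simps)
  qed (simp_all add: top_jet_def)
  moreover have "jupd ?d 0 ?Q = ?Q"
  proof (rule jet_eqI)
    show "jU (jupd ?d 0 ?Q) i j = jU ?Q i j" for i j
      using Suc.prems low by (auto simp: jU_jupd top_jet_def simp del: jupd.simps)
  qed (simp_all add: top_jet_def)
  ultimately show ?case using Suc by simp
qed

section \<open>Independence of exponentials and irrational parameters\<close>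

text \<open>Dividing by the last exponential and differentiating removes the last term and
  multiplies the other coefficients by \<open>r i - r n\<close>, which is nonzero.\<close>

lemma exp_independent:
  fixes c r :: "nat \<Rightarrow> real"
  assumes "\<And>t. (\<Sum>i<n. c i * exp (r i * t)) = 0" "inj_on r {..<n}"
  shows "\<forall>i<n. c i = 0"
  using assms
proof (induction n arbitrary: c)
  case (Suc n)
  have eq: "(\<Sum>i<n. c i * exp ((r i - r n) * t)) + c n = 0" for t
  proof -
    have "(\<Sum>i<n. c i * exp ((r i - r n) * t)) + c n = exp (- r n * t) * (\<Sum>i<Suc n. c i * exp (r i * t))"
      by (simp add: sum_distrib_left algebra_simps exp_diff exp_minus field_simps)
    then show ?thesis using Suc.prems by simp
  qed
  have "((\<lambda>t. (\<Sum>i<n. c i * exp ((r i - r n) * t)) + c n) has_real_derivative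
     (\<Sum>i<n. c i * (r i - r n) * exp ((r i - r n) * t))) (at t)" for t
    by (auto intro!: derivative_eq_intros sum.cong simp: algebra_simps)
  then have 0: "(\<Sum>i<n. c i * (r i - r n) * exp ((r i - r n) * t)) = 0" for t
    unfolding eq using DERIV_unique[OF _ DERIV_const] by blast
  have "(\<Sum>i<n. c i * (r i - r n) * exp (r i * t)) = exp (r n * t) * (\<Sum>i<n. c i * (r i - r n) * exp ((r i - r n) * t))" for t
  proof -
    have "exp (r n * t) * exp ((r i - r n) * t) = exp (r i * t)" for i
      by (simp add: exp_add[symmetric] algebra_simps)
    then show ?thesis by (simp only: sum_distrib_left mult.left_commute[of "exp (r n * t)"])
  qed
  then have "(\<Sum>i<n. c i * (r i - r n) * exp (r i * t)) = 0" for t by (simp add: 0)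
  then have "\<forall>i<n. c i * (r i - r n) = 0"
    using Suc.prems(2) by (intro Suc.IH) (auto simp: inj_on_def)
  moreover have "r i \<noteq> r n" if "i < n" for i
    using Suc.prems(2) that by (auto simp: inj_on_def)
  ultimately have c: "c i = 0" if "i < n" for i using that by auto
  then have "c n = 0" using eq[of 0] by simp
  then show ?case using c by (auto simp: less_Suc_eq)
qed simp

text \<open>The expressions in \<open>m\<close> that must not vanish below are affine in
  \<open>m\<close> with rational coefficients, which is why the rationals suffice as exceptional
  set.\<close>

lemma irrational_affine_nonzero:
  fixes m :: real
  assumes "m \<notin> \<rat>" "a \<in> \<rat>" "b \<in> \<rat>" "a \<noteq> 0 \<or> b \<noteq> 0"
  shows "a * m + b \<noteq> 0"
proof
  assume 0: "a * m + b = 0"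
  show False
  proof (cases "a = 0")
    case False
    then have "m = - b / a" using 0 by (simp add: field_simps)
    then show False using assms by simp
  qed (use 0 assms in simp)
qed

section \<open>Tangency to the system\<close>

text \<open>Along a curve in the system the parameter is differentiable, being the coordinate
  u_{k,0} itself (case \<open>i = 0\<close>). Differentiating the other equations through it gives
  the relation.\<close>

lemma tangent_sysF_imp:
  assumes tan: "tangent_to k (sysF k m) P vx vy V" and P: "\<And>i. i \<le> k \<Longrightarrow> jU P (k - i) i = lam powr (real i * m + 1) / (real i * m + 1)"
    and lam: "lam > 0" and m: "\<And>i. i \<le> k \<Longrightarrow> real i * m + 1 \<noteq> 0" and i: "i \<le> k"
  shows "V (k - i) i = lam powr (real i * m) * V k 0"
proof -
  obtain \<gamma> e where e: "e > 0" and g0: "\<gamma> 0 = P" and S: "\<And>t. \<bar>t\<bar> < e \<Longrightarrow> \<gamma> t \<in> sysF k m"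
    and D: "\<And>i j. i + j \<le> k \<Longrightarrow> ((\<lambda>t. jU (\<gamma> t) i j) has_real_derivative V i j) (at 0)"
    using tan unfolding tangent_to_def by blast
  define L where "L t = jU (\<gamma> t) k 0" for t
  have L: "(L has_real_derivative V k 0) (at 0)" unfolding L_def using D[of k 0] by simp
  have L0: "L 0 = lam" using P[of 0] lam by (simp add: L_def g0)
  have eq: "jU (\<gamma> t) (k - i) i = L t powr (real i * m + 1) / (real i * m + 1)" if t: "\<bar>t\<bar> < e" for t
  proof -
    obtain l where l: "l > 0" "\<And>i. i \<le> k \<Longrightarrow> jU (\<gamma> t) (k - i) i = l powr (real i * m + 1) / (real i * m + 1)"
      using S[OF t] unfolding sysF_def by blast
    have "L t = l" using l(2)[of 0] l(1) by (simp add: L_def)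
    then show ?thesis using l(2)[OF i] by simp
  qed
  have "((\<lambda>t. L t powr (real i * m + 1) / (real i * m + 1)) has_real_derivative
     lam powr (real i * m) * V k 0) (at 0)"
    using m[OF i] lam by (auto intro!: derivative_eq_intros L simp: L0)
  moreover have "((\<lambda>t. L t powr (real i * m + 1) / (real i * m + 1)) has_real_derivative V (k - i) i) (at 0)"
  proof (rule has_field_derivative_transform_within_open[OF D[of "k - i" i], of "{-e<..<e}"])
    show "(k - i) + i \<le> k" using i by simp
  qed (use e eq in auto)
  ultimately show ?thesis using DERIV_unique by blast
qed

text \<open>The required curve moves the parameter along \<open>lam + t * v\<close>, which
  determines the coordinates of order \<open>k\<close>, and all remaining coordinates
  linearly.\<close>

lemma tangent_sysFI:
  assumes P: "\<And>i. i \<le> k \<Longrightarrow> jU P (k - i) i = lam powr (real i * m + 1) / (real i * m + 1)"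
    and lam: "lam > 0" and m: "\<And>i. i \<le> k \<Longrightarrow> real i * m + 1 \<noteq> 0"
    and V: "\<And>i. i \<le> k \<Longrightarrow> V (k - i) i = lam powr (real i * m) * v"
  shows "tangent_to k (sysF k m) P vx vy V"
proof -
  define \<gamma> :: "real \<Rightarrow> jetpt" where "\<gamma> t = (jx P + t * vx, jy P + t * vy,
     \<lambda>i j. if i + j = k then (lam + t * v) powr (real j * m + 1) / (real j * m + 1) else jU P i j + t * V i j)" for t
  \<comment> \<open>Keeps the parameter positive; the added 1 covers \<open>v = 0\<close>.\<close>
  define e where "e = lam / (\<bar>v\<bar> + 1)"
  have e: "e > 0" using lam by (simp add: e_def)
  have pos: "lam + t * v > 0" if "\<bar>t\<bar> < e" for t
  proof -
    have "\<bar>t * v\<bar> \<le> \<bar>t\<bar> * (\<bar>v\<bar> + 1)" by (simp add: abs_mult mult_left_mono)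
    also have "\<dots> < lam" using that by (simp add: e_def field_simps)
    finally show ?thesis by linarith
  qed
  have PU: "jU P i j = lam powr (real j * m + 1) / (real j * m + 1)" "V i j = lam powr (real j * m) * v"
     if "i + j = k" for i j
    using P[of j] V[of j] that by (metis diff_add_inverse2 le_add2)+
  show ?thesis
    unfolding tangent_to_def
  proof (intro exI[of _ \<gamma>] exI[of _ e] conjI allI impI)
    show "\<gamma> 0 = P" by (auto simp: \<gamma>_def PU intro!: jet_eqI)
    show "\<gamma> t \<in> sysF k m" if "\<bar>t\<bar> < e" for t
      using pos[OF that] by (auto simp: sysF_def \<gamma>_def intro!: exI[of _ "lam + t * v"])
    fix i j assume ij: "i + j \<le> k"
    show "((\<lambda>t. jU (\<gamma> t) i j) has_real_derivative V i j) (at 0)"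
    proof (cases "i + j = k")
      case True
      then show ?thesis using m[of j] lam PU[OF True] by (auto simp: \<gamma>_def intro!: derivative_eq_intros)
    qed (auto simp: \<gamma>_def intro!: derivative_eq_intros)
  qed (auto simp: \<gamma>_def e intro!: derivative_eq_intros)
qed

section \<open>The determining equations\<close>

context
  fixes f :: "j1pt \<Rightarrow> real" and k :: nat
  assumes f: "smooth_j1 f" and k: "k > 2"
begin

text \<open>\<open>DXk\<close> and \<open>DXDY\<close> are the components of the prolongation along
  u_{k,0} and u_{k-1,1}, up to terms with coordinates of order \<open>k + 1\<close>.\<close>

abbreviation (input) "DXk \<equiv> (totDx k ^^ k) (lift1 f)"
abbreviation (input) "DXDY \<equiv> (totDx k ^^ (k - 1)) (totDy k (lift1 f))"

private lemma jet_f: "jetpoly (lift1 f)" "jetpoly (totDy k (lift1 f))" "jetpoly (lift1 (pd1 3 f))" "jetpoly (lift1 (pd1 4 f))"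
  "jetpoly (lift1 (pd1 2 f))"
  by (auto intro!: jetpoly.intros jetpoly_totDy smooth_j1_pd1 f)

private lemma pdd_f: "pdd (DU i j) (lift1 f) = (if i = 0 \<and> j = 0 then lift1 (pd1 2 f)
    else if i = 1 \<and> j = 0 then lift1 (pd1 3 f) else if i = 0 \<and> j = 1 then lift1 (pd1 4 f) else (\<lambda>P. 0))"
  by (simp add: pdd_lift1 f)

private lemma totDy_zero [simp]: "totDy k (\<lambda>P. 0) = (\<lambda>P. 0)"
  by (simp add: totDy_eq)

private lemma pdd_Dyf_0: "pdd (DU i 0) (totDy k (lift1 f)) = totDy k (pdd (DU i 0) (lift1 f))"
  by (rule ext) (simp add: pdd_totDy jet_f)

private lemma pdd_Dyf_Suc: "pdd (DU i (Suc j)) (totDy k (lift1 f)) =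
    (\<lambda>P. totDy k (pdd (DU i (Suc j)) (lift1 f)) P + (if i + j \<le> k then pdd (DU i j) (lift1 f) P else 0))"
  by (rule ext) (simp add: pdd_totDy jet_f)

text \<open>Instances of the expansion with second index 0, where the inner derivatives are f_u and
  f_p, and with second index 1, where they are f_q and 0. The derivative in u_{k-1,0} is for the
  later step that differentiates the equation D_x^k f = 0.\<close>

lemma DXk_coeffs:
  shows "pdd (DU k 0) DXk = (\<lambda>P. lift1 (pd1 2 f) P + real k * totDx k (lift1 (pd1 3 f)) P)"
    and "pdd (DU (k - 1) 0) DXk =
      (\<lambda>P. real k * totDx k (lift1 (pd1 2 f)) P + real k * (real k - 1) / 2 * totDx k (totDx k (lift1 (pd1 3 f))) P)"
    and "pdd (DU (k - 1) 1) DXk = (\<lambda>P. real k * totDx k (lift1 (pd1 4 f)) P)"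
    and "i \<ge> 2 \<Longrightarrow> pdd (DU j i) DXk = (\<lambda>P. 0)"
proof -
  have 0: "pdd (DU j 0) (lift1 f) = (\<lambda>P. 0)" if "j \<ge> 2" for j using that by (simp add: pdd_f)
  have 1: "pdd (DU j 1) (lift1 f) = (\<lambda>P. 0)" if "j \<ge> 2" for j using that by (simp add: pdd_f)
  show "pdd (DU k 0) DXk = (\<lambda>P. lift1 (pd1 2 f) P + real k * totDx k (lift1 (pd1 3 f)) P)"
    using pdd_totDx_pow_same[OF jet_f(1) 0, of k k] by (simp add: pdd_f)
  show "pdd (DU (k - 1) 0) DXk =
      (\<lambda>P. real k * totDx k (lift1 (pd1 2 f)) P + real k * (real k - 1) / 2 * totDx k (totDx k (lift1 (pd1 3 f))) P)"
    using pdd_totDx_pow_pred[OF jet_f(1) 0, of "k - 1" k] k by (simp add: pdd_f of_nat_diff del: funpow.simps)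
  show "pdd (DU (k - 1) 1) DXk = (\<lambda>P. real k * totDx k (lift1 (pd1 4 f)) P)"
    using pdd_totDx_pow_pred[OF jet_f(1) 1, of "k - 1" k] k by (simp add: pdd_f of_nat_diff del: funpow.simps)
  show "i \<ge> 2 \<Longrightarrow> pdd (DU j i) DXk = (\<lambda>P. 0)"
    by (rule pdd_totDx_pow_zero[OF jet_f(1)]) (simp add: pdd_f)
qed

text \<open>The same expansion applied to D_y f, whose own coordinate derivatives pick up f_u, f_p
  and f_q from the commutator with D_y.\<close>

lemma DXDY_coeffs:
  shows "pdd (DU k 0) DXDY = totDy k (lift1 (pd1 3 f))"
    and "pdd (DU (k - 1) 0) DXDY =
      (\<lambda>P. totDy k (lift1 (pd1 2 f)) P + (real k - 1) * totDx k (totDy k (lift1 (pd1 3 f))) P)"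
    and "pdd (DU (k - 1) 1) DXDY =
      (\<lambda>P. totDy k (lift1 (pd1 4 f)) P + lift1 (pd1 2 f) P + (real k - 1) * totDx k (lift1 (pd1 3 f)) P)"
    and "pdd (DU (k - 2) 2) DXDY = (\<lambda>P. (real k - 1) * totDx k (lift1 (pd1 4 f)) P)"
    and "i \<ge> 3 \<Longrightarrow> pdd (DU j i) DXDY = (\<lambda>P. 0)"
proof -
  let ?G = "totDy k (lift1 f)"
  have 0: "pdd (DU j 0) ?G = (\<lambda>P. 0)" if "j \<ge> 2" for j using that by (simp add: pdd_Dyf_0 pdd_f)
  have 1: "pdd (DU j (Suc 0)) ?G = (\<lambda>P. 0)" if "j \<ge> 2" for j using that by (auto simp: pdd_Dyf_Suc pdd_f)
  have 2: "pdd (DU j 2) ?G = (\<lambda>P. 0)" if "j \<ge> 2" for j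
    using that by (auto simp: pdd_Dyf_Suc pdd_f numeral_2_eq_2)
  show "pdd (DU k 0) DXDY = totDy k (lift1 (pd1 3 f))"
    using pdd_totDx_pow_Suc[OF jet_f(2) 0, of "k - 1" k] k by (simp add: pdd_f pdd_Dyf_0)
  show "pdd (DU (k - 1) 0) DXDY =
      (\<lambda>P. totDy k (lift1 (pd1 2 f)) P + (real k - 1) * totDx k (totDy k (lift1 (pd1 3 f))) P)"
    using pdd_totDx_pow_same[OF jet_f(2) 0, of "k - 1" k] k by (simp add: pdd_f pdd_Dyf_0 of_nat_diff)
  have g: "pdd (DU 0 (Suc 0)) ?G = (\<lambda>P. totDy k (lift1 (pd1 4 f)) P + lift1 (pd1 2 f) P)"
     "pdd (DU (Suc 0) (Suc 0)) ?G = lift1 (pd1 3 f)"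
     "pdd (DU 0 (Suc (Suc 0))) ?G = lift1 (pd1 4 f)"
     "pdd (DU (Suc 0) (Suc (Suc 0))) ?G = (\<lambda>P. 0)"
    using k by (simp_all add: pdd_Dyf_Suc pdd_f)
  have "pdd (DU (k - 1) (Suc 0)) DXDY =
      (\<lambda>P. totDy k (lift1 (pd1 4 f)) P + lift1 (pd1 2 f) P + (real k - 1) * totDx k (lift1 (pd1 3 f)) P)"
    using pdd_totDx_pow_same[OF jet_f(2) 1, of "k - 1" k] k by (simp add: g of_nat_diff)
  then show "pdd (DU (k - 1) 1) DXDY =
      (\<lambda>P. totDy k (lift1 (pd1 4 f)) P + lift1 (pd1 2 f) P + (real k - 1) * totDx k (lift1 (pd1 3 f)) P)"
    by simp
  show "pdd (DU (k - 2) 2) DXDY = (\<lambda>P. (real k - 1) * totDx k (lift1 (pd1 4 f)) P)"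
    using pdd_totDx_pow_pred[OF jet_f(2) 2, of "k - 2" k] k Suc_diff_Suc[of 1 k]
    by (simp add: g numeral_2_eq_2 of_nat_diff del: funpow.simps)
  show "i \<ge> 3 \<Longrightarrow> pdd (DU j i) DXDY = (\<lambda>P. 0)"
    by (rule pdd_totDx_pow_zero[OF jet_f(2)], cases i) (auto simp add: pdd_f pdd_Dyf_Suc)
qed

lemma top_jet_DXk:
  assumes P: "\<And>i j. i + j = k \<Longrightarrow> jU P i j = 0"
  shows "DXk (top_jet k c (Suc k) P) = DXk P
     + c 0 * (lift1 (pd1 2 f) P + real k * totDx k (lift1 (pd1 3 f)) P)
     + c 1 * (real k * totDx k (lift1 (pd1 4 f)) P)"
proof -
  have cases: "i = 0 \<or> i = 1 \<or> i \<ge> 2" for i :: nat by linarith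
  have "DXk (top_jet k c (Suc k) P) = DXk P + (\<Sum>i<Suc k. c i * pdd (DU (k - i) i) DXk P)"
  proof (rule top_jet_affine)
    fix i and Q :: jetpt
    assume Q: "jx Q = jx P" "jy Q = jy P" "\<And>a b. a + b < k \<Longrightarrow> jU Q a b = jU P a b"
    show "pdd (DU (k - i) i) DXk Q = pdd (DU (k - i) i) DXk P"
      \<comment> \<open>The coefficients involve jets of order at most 2, and \<open>k > 2\<close>;
        so no coordinate of order \<open>k\<close> enters them.\<close>
      using cases[of i] DXk_coeffs k Q
      by (auto simp: totDx_lift1 smooth_j1_pd1 f lift1_def)
  qed (use P jet_f in \<open>auto intro: jetpoly_totDx_pow\<close>)
  also have "(\<Sum>i<Suc k. c i * pdd (DU (k - i) i) DXk P) = (\<Sum>i\<in>{0, 1}. c i * pdd (DU (k - i) i) DXk P)"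
    using k by (intro sum.mono_neutral_right) (auto simp: DXk_coeffs(4))
  finally show ?thesis using DXk_coeffs by simp
qed

lemma top_jet_DXDY:
  assumes P: "\<And>i j. i + j = k \<Longrightarrow> jU P i j = 0"
  shows "DXDY (top_jet k c (Suc k) P) = DXDY P
     + c 0 * totDy k (lift1 (pd1 3 f)) P
     + c 1 * (totDy k (lift1 (pd1 4 f)) P + lift1 (pd1 2 f) P + (real k - 1) * totDx k (lift1 (pd1 3 f)) P)
     + c 2 * ((real k - 1) * totDx k (lift1 (pd1 4 f)) P)"
proof -
  have cases: "i = 0 \<or> i = 1 \<or> i = 2 \<or> i \<ge> 3" for i :: nat by linarith
  have "DXDY (top_jet k c (Suc k) P) = DXDY P + (\<Sum>i<Suc k. c i * pdd (DU (k - i) i) DXDY P)"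
  proof (rule top_jet_affine)
    fix i and Q :: jetpt
    assume Q: "jx Q = jx P" "jy Q = jy P" "\<And>a b. a + b < k \<Longrightarrow> jU Q a b = jU P a b"
    show "pdd (DU (k - i) i) DXDY Q = pdd (DU (k - i) i) DXDY P"
      using cases[of i] DXDY_coeffs k Q
      by (auto simp: totDx_lift1 totDy_lift1 smooth_j1_pd1 f lift1_def)
  qed (use P jet_f in \<open>auto intro: jetpoly_totDx_pow\<close>)
  also have "(\<Sum>i<Suc k. c i * pdd (DU (k - i) i) DXDY P) = (\<Sum>i\<in>{0, 1, 2}. c i * pdd (DU (k - i) i) DXDY P)"
  proof (intro sum.mono_neutral_right)
    have "pdd (DU (k - i) i) DXDY P = 0" if "i \<ge> 3" for i
      by (simp only: DXDY_coeffs(5)[OF that])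
    then show "\<forall>i\<in>{..<Suc k} - {0, 1, 2}. c i * pdd (DU (k - i) i) DXDY P = 0"
      using cases by (metis DiffD2 insertCI mult_zero_right)
  qed (use k in auto)
  finally show ?thesis using DXDY_coeffs by simp
qed

text \<open>For each \<open>t\<close>, tangency at the jet over \<open>P\<close> with parameter
  \<open>exp t\<close> gives one identity; \<open>top_jet_DXk\<close> and
  \<open>top_jet_DXDY\<close> turn it into an exponential sum in \<open>t\<close> whose coefficients
  depend on \<open>P\<close> only.\<close>

lemma determining_equations:
  assumes m: "m \<notin> \<rat>" and sym: "contact_symmetry k (sysF k m) f"
    and P: "\<And>i j. i + j \<ge> k \<Longrightarrow> jU P i j = 0"
  shows "DXk P = 0" "DXDY P = 0"
    "totDy k (lift1 (pd1 3 f)) P = 0" "totDx k (lift1 (pd1 4 f)) P = 0"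
    "totDy k (lift1 (pd1 4 f)) P - totDx k (lift1 (pd1 3 f)) P
       = m * (lift1 (pd1 2 f) P + real k * totDx k (lift1 (pd1 3 f)) P)"
proof -
  have m0: "real i * m + 1 \<noteq> 0" for i
    by (rule irrational_affine_nonzero[OF m]) auto
  have m1: "m \<noteq> 0" "m \<noteq> 1" "m + 1 \<noteq> 0" "2 * m + 1 \<noteq> 0" "m \<noteq> - 1"
    using m m0[of 1] m0[of 2] by auto
  let ?dyp = "totDy k (lift1 (pd1 3 f)) P" and ?dxq = "totDx k (lift1 (pd1 4 f)) P"
  let ?R = "lift1 (pd1 2 f) P + real k * totDx k (lift1 (pd1 3 f)) P"
  let ?S = "totDy k (lift1 (pd1 4 f)) P + lift1 (pd1 2 f) P + (real k - 1) * totDx k (lift1 (pd1 3 f)) P"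
  \<comment> \<open>Coefficients and exponents of the powers of the parameter after everything has
    been moved to the side of D_x^{k-1} D_y f.\<close>
  let ?c = "[DXDY P, ?dyp, ?S / (m + 1) - ?R, ((real k - 1) / (2 * m + 1) - real k / (m + 1)) * ?dxq, - DXk P]"
  let ?r = "[0, 1, m + 1, 2 * m + 1, m]"
  have collect: "b0 + p * E1 + (S / (m + 1) - R) * E2 + ((real k - 1) / (2 * m + 1) - real k / (m + 1)) * q * E3 - a0 * E = 0"
    if "b0 + E1 * p + E2 / (m + 1) * S + E3 / (2 * m + 1) * ((real k - 1) * q)
      = E * a0 + E2 * R + E3 / (m + 1) * (real k * q)" for b0 p E1 E2 E3 E S R q a0 :: real
    using that by (simp add: algebra_simps diff_divide_distrib)
  have "(\<Sum>i<5. ?c ! i * exp (?r ! i * t)) = 0" for t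
  proof -
    define c where "c i = exp t powr (real i * m + 1) / (real i * m + 1)" for i :: nat
    define Q where "Q = top_jet k c (Suc k) P"
    have QU: "i \<le> k \<Longrightarrow> jU Q (k - i) i = c i" for i by (simp add: Q_def top_jet_def)
    then have "Q \<in> sysF k m" unfolding sysF_def c_def by (auto intro!: exI[of _ "exp t"])
    then have "tangent_to k (sysF k m) Q (prol_x f Q) (prol_y f Q) (\<lambda>i j. prol_U k f i j Q)"
      using sym by (simp add: contact_symmetry_def)
    from tangent_sysF_imp[OF this, of "exp t" 1] QU m0 k
    have "prol_U k f (k - 1) 1 Q = exp t powr m * prol_U k f k 0 Q"
      by (simp add: c_def)
    \<comment> \<open>The subtracted terms carry coordinates of order \<open>k + 1\<close>, which
      are zero in \<open>Q\<close>.\<close>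
    moreover have "prol_U k f (k - 1) 1 Q = DXDY Q" "prol_U k f k 0 Q = DXk Q"
      using k P by (simp_all add: prol_U_def Q_def top_jet_def)
    ultimately have "DXDY Q = exp t powr m * DXk Q" by simp
    then have *: "DXDY P + c 0 * ?dyp + c 1 * ?S + c 2 * ((real k - 1) * ?dxq)
       = exp t powr m * (DXk P + c 0 * ?R + c 1 * (real k * ?dxq))"
    proof -
      have "DXk Q = DXk P + c 0 * ?R + c 1 * (real k * ?dxq)"
        unfolding Q_def by (rule top_jet_DXk) (simp add: P)
      moreover have "DXDY Q = DXDY P + c 0 * ?dyp + c 1 * ?S + c 2 * ((real k - 1) * ?dxq)"
        unfolding Q_def by (rule top_jet_DXDY) (simp add: P)
      ultimately show ?thesis using \<open>DXDY Q = exp t powr m * DXk Q\<close> by (simp only:)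
    qed
    have E: "c 0 = exp t" "c 1 = exp ((m + 1) * t) / (m + 1)" "c 2 = exp ((2 * m + 1) * t) / (2 * m + 1)"
      "exp t powr m = exp (m * t)" "exp (m * t) * exp t = exp ((m + 1) * t)"
      "exp (m * t) * exp ((m + 1) * t) = exp ((2 * m + 1) * t)"
      by (simp_all add: c_def powr_def exp_add[symmetric] algebra_simps)
    have "exp (m * t) * (DXk P + exp t * ?R + exp ((m + 1) * t) / (m + 1) * (real k * ?dxq))
      = exp (m * t) * DXk P + (exp (m * t) * exp t) * ?R + (exp (m * t) * exp ((m + 1) * t)) / (m + 1) * (real k * ?dxq)"
      by (simp add: algebra_simps)
    then have lin: "DXDY P + exp t * ?dyp + exp ((m + 1) * t) / (m + 1) * ?S
        + exp ((2 * m + 1) * t) / (2 * m + 1) * ((real k - 1) * ?dxq)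
      = exp (m * t) * DXk P + exp ((m + 1) * t) * ?R + exp ((2 * m + 1) * t) / (m + 1) * (real k * ?dxq)"
      using * unfolding E by linarith
    have "(\<Sum>i<5. ?c ! i * exp (?r ! i * t)) = DXDY P + ?dyp * exp t
       + (?S / (m + 1) - ?R) * exp ((m + 1) * t)
       + ((real k - 1) / (2 * m + 1) - real k / (m + 1)) * ?dxq * exp ((2 * m + 1) * t) - DXk P * exp (m * t)"
      by (simp add: eval_nat_numeral)
    also have "\<dots> = 0" by (rule collect[OF lin])
    finally show ?thesis .
  qed
  moreover have "inj_on (\<lambda>i. ?r ! i) {..<5}"
    using m1 by (auto simp: inj_on_def eval_nat_numeral less_Suc_eq)
  ultimately have 0: "\<forall>i<5. ?c ! i = 0" by (rule exp_independent)
  show "DXk P = 0" using 0[rule_format, of 4] by simp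
  show "DXDY P = 0" using 0[rule_format, of 0] by simp
  show "?dyp = 0" using 0[rule_format, of 1] by simp
  \<comment> \<open>The numerator of the factor in front of \<open>?dxq\<close> after bringing it to
    a common denominator.\<close>
  have "(real k - 1) * (m + 1) - real k * (2 * m + 1) = (- real k - 1) * m + (- 1)" by (simp add: algebra_simps)
  also have "\<dots> \<noteq> 0" by (rule irrational_affine_nonzero[OF m]) auto
  finally have "(real k - 1) / (2 * m + 1) - real k / (m + 1) \<noteq> 0"
    using m1 by (simp add: frac_eq_eq)
  then show "?dxq = 0" using 0[rule_format, of 3] by simp
  have "?S / (m + 1) - ?R = 0" using 0[rule_format, of 2] by simp
  \<comment> \<open>Since \<open>?S - ?R\<close> is D_y f_q - D_x f_p, this is the last
    claim.\<close>
  then have "?S = (m + 1) * ?R" using m1 by (simp add: field_simps)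
  then show "totDy k (lift1 (pd1 4 f)) P - totDx k (lift1 (pd1 3 f)) P = m * ?R"
    by (simp add: algebra_simps)
qed

end

section \<open>Integrating the determining equations\<close>

lemma pd1_lincomb:
  assumes "smooth_j1 g" "smooth_j1 h" "i < 5"
  shows "pd1 i (\<lambda>z. a * g z + b * h z) = (\<lambda>z. a * pd1 i g z + b * pd1 i h z)"
  by (rule ext, subst pd1_def, rule DERIV_imp_deriv)
    (auto intro!: derivative_eq_intros has_derivative_pd1 assms)

lemma pd1_const [simp]: "pd1 i (\<lambda>z. c) = (\<lambda>z. 0)"
  by (simp add: fun_eq_iff pd1_def)

lemma constant_pd1_line:
  assumes g: "smooth_j1 g" "i < 5" and c: "\<And>s. pd1 i g (upd1 i s z) = c"
  shows "g (upd1 i t z) = g (upd1 i s z) + c * (t - s)"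
proof -
  have "((\<lambda>t. g (upd1 i t z) - c * t) has_real_derivative 0) (at t)" for t
    using has_derivative_pd1_line[OF g, of z t] by (auto intro!: derivative_eq_intros simp: c)
  then have "g (upd1 i t z) - c * t = g (upd1 i s z) - c * s"
    using DERIV_isconst_all by blast
  then show ?thesis by (simp add: algebra_simps)
qed

lemma affine_if_constant_pd1:
  assumes g: "smooth_j1 g" and c: "\<And>i. i < 5 \<Longrightarrow> pd1 i g = (\<lambda>z. c i)"
  shows "g (x, y, u, p, q) = g (0, 0, 0, 0, 0) + c 0 * x + c 1 * y + c 2 * u + c 3 * p + c 4 * q"
  using constant_pd1_line[OF g, of 0 "(0, y, u, p, q)" "c 0" x 0]
    constant_pd1_line[OF g, of 1 "(0, 0, u, p, q)" "c 1" y 0]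
    constant_pd1_line[OF g, of 2 "(0, 0, 0, p, q)" "c 2" u 0]
    constant_pd1_line[OF g, of 3 "(0, 0, 0, 0, q)" "c 3" p 0]
    constant_pd1_line[OF g, of 4 "(0, 0, 0, 0, 0)" "c 4" q 0]
  by (simp add: c)

text \<open>As \<open>k > 2\<close>, these jets meet the vanishing hypothesis of
  \<open>determining_equations\<close>, while the second-order coordinates \<open>r\<close>,
  \<open>s\<close>, \<open>t\<close> stay arbitrary.\<close>

fun jet2 :: "j1pt \<Rightarrow> real \<Rightarrow> real \<Rightarrow> real \<Rightarrow> jetpt" where
  "jet2 (x, y, u, p, q) r s t = (x, y, \<lambda>i j.
     if i = 0 \<and> j = 0 then u else if i = 1 \<and> j = 0 then p else if i = 0 \<and> j = 1 then q
     else if i = 2 \<and> j = 0 then r else if i = 1 \<and> j = 1 then s else if i = 0 \<and> j = 2 then t else 0)"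

lemma jU_jet2_high: "i + j > 2 \<Longrightarrow> jU (jet2 z r s t) i j = 0"
  by (cases z) auto

lemma lift1_jet2: "lift1 g (jet2 z r s t) = g z"
  by (cases z) (simp add: lift1_def)

lemma jU_jet2:
  "jU (jet2 (x, y, u, p, q) r s t) 1 0 = p" "jU (jet2 (x, y, u, p, q) r s t) 0 1 = q"
  "jU (jet2 z r s t) 2 0 = r" "jU (jet2 z r s t) 1 1 = s" "jU (jet2 z r s t) 0 2 = t"
  by (auto intro: prod.induct[where prod = z])

text \<open>Write a, b, c for f_u, f_p, f_q. The free second-order coordinates force b to depend on
  x alone and c on y alone; the last determining equation then expresses a by b_x and c_y;
  differentiating the two order-k equations in u_{k-1,0} kills b_xx and c_yy.\<close>

proposition symmetry_affine_form:
  assumes k: "k > 2" and m: "m \<notin> \<rat>" and sym: "contact_symmetry k (sysF k m) f"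
  obtains \<alpha> \<beta> \<delta> A B where "\<delta> - \<beta> = m * (\<alpha> + real k * \<beta>)"
    "\<And>x y u p q. f (x, y, u, p, q) = f (x, y, 0, 0, 0) + \<alpha> * u + (A + \<beta> * x) * p + (B + \<delta> * y) * q"
proof -
  have f: "smooth_j1 f" using sym by (simp add: contact_symmetry_def)
  have sm: "smooth_j1 (pd1 i g)" if "smooth_j1 g" "i < 5" for i g using that by (rule smooth_j1_pd1)
  have com: "pd1 i (pd1 j g) = pd1 j (pd1 i g)" if "smooth_j1 g" "i < 5" "j < 5" for i j g
    using that by (rule pd1_commute)
  define a b c where abc: "a = pd1 2 f" "b = pd1 3 f" "c = pd1 4 f"
  have s: "smooth_j1 a" "smooth_j1 b" "smooth_j1 c" unfolding abc using f by (auto intro: sm)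
  have high: "jU (jet2 z r s t) i j = 0" if "i + j \<ge> k" for z r s t i j
    using that k by (intro jU_jet2_high) simp
  note det = determining_equations[OF f k m sym high, folded abc]
  have Dy: "totDy k (lift1 g) (jet2 (x, y, u, p, q) r s t) = pd1 1 g (x, y, u, p, q) + q * pd1 2 g (x, y, u, p, q)
      + s * pd1 3 g (x, y, u, p, q) + t * pd1 4 g (x, y, u, p, q)"
    and Dx: "totDx k (lift1 g) (jet2 (x, y, u, p, q) r s t) = pd1 0 g (x, y, u, p, q) + p * pd1 2 g (x, y, u, p, q)
      + r * pd1 3 g (x, y, u, p, q) + s * pd1 4 g (x, y, u, p, q)" if "smooth_j1 g" for g x y u p q r s t
    using k that by (simp_all add: totDx_lift1 totDy_lift1 lift1_jet2 jU_jet2[unfolded One_nat_def] del: jet2.simps)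
  have b_eq: "pd1 1 b (x, y, u, p, q) + q * pd1 2 b (x, y, u, p, q)
      + s * pd1 3 b (x, y, u, p, q) + t * pd1 4 b (x, y, u, p, q) = 0" for x y u p q s t
    using det(3)[of "(x, y, u, p, q)" 0 s t] by (simp only: Dy[OF s(2)])
  have c_eq: "pd1 0 c (x, y, u, p, q) + p * pd1 2 c (x, y, u, p, q)
      + r * pd1 3 c (x, y, u, p, q) + t * pd1 4 c (x, y, u, p, q) = 0" for x y u p q r t
    using det(4)[of "(x, y, u, p, q)" r t 0] by (simp only: Dx[OF s(3)])
  \<comment> \<open>The equation is affine in \<open>s\<close> and \<open>t\<close>, so the values 0
    and 1 isolate the coefficients.\<close>
  have b34: "pd1 3 b = (\<lambda>z. 0)" "pd1 4 b = (\<lambda>z. 0)"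
  proof -
    show "pd1 3 b = (\<lambda>z. 0)"
    proof
      fix z show "pd1 3 b z = 0"
        by (cases z) (use b_eq[of _ _ _ _ _ 0 0] b_eq[of _ _ _ _ _ 1 0] in fastforce)
    qed
    show "pd1 4 b = (\<lambda>z. 0)"
    proof
      fix z show "pd1 4 b z = 0"
        by (cases z) (use b_eq[of _ _ _ _ _ 0 0] b_eq[of _ _ _ _ _ 0 1] in fastforce)
    qed
  qed
  have c34: "pd1 3 c = (\<lambda>z. 0)" "pd1 4 c = (\<lambda>z. 0)"
  proof -
    show "pd1 3 c = (\<lambda>z. 0)"
    proof
      fix z show "pd1 3 c z = 0"
        by (cases z) (use c_eq[of _ _ _ _ _ 0 0] c_eq[of _ _ _ _ _ 1 0] in fastforce)
    qed
    show "pd1 4 c = (\<lambda>z. 0)"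
    proof
      fix z show "pd1 4 c z = 0"
        by (cases z) (use c_eq[of _ _ _ _ _ 0 0] c_eq[of _ _ _ _ _ 0 1] in fastforce)
    qed
  qed
  have b2: "pd1 2 b = (\<lambda>z. 0)"
  proof
    fix z :: j1pt
    obtain x y u p q where z: "z = (x, y, u, p, q)" by (cases z)
    \<comment> \<open>The partials of \<open>b\<close> do not change with \<open>q\<close>, so
      comparing \<open>q\<close> with \<open>q + 1\<close> in b_y + q b_u = 0 leaves b_u =
      0.\<close>
    have "pd1 4 (pd1 i b) = (\<lambda>z. 0)" if "i < 5" for i using com[OF s(2), of 4 i] that by (simp add: b34)
    then have "pd1 i b (x, y, u, p, q + 1) = pd1 i b (x, y, u, p, q)" if "i < 5" for i
      using constant_pd1_line[OF sm[OF s(2) that], of 4 "(x, y, u, p, q)" 0 "q + 1" q] that by simp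
    from this[of 1] this[of 2] show "pd1 2 b z = 0"
      using b_eq[of x y u p q 0 0] b_eq[of x y u p "q + 1" 0 0] by (simp add: z algebra_simps)
  qed
  then have b1: "pd1 1 b = (\<lambda>z. 0)"
    using b_eq[of _ _ _ _ _ 0 0] by (auto simp: fun_eq_iff)
  have c2: "pd1 2 c = (\<lambda>z. 0)"
  proof
    fix z :: j1pt
    obtain x y u p q where z: "z = (x, y, u, p, q)" by (cases z)
    have "pd1 3 (pd1 i c) = (\<lambda>z. 0)" if "i < 5" for i using com[OF s(3), of 3 i] that by (simp add: c34)
    then have "pd1 i c (x, y, u, p + 1, q) = pd1 i c (x, y, u, p, q)" if "i < 5" for i
      using constant_pd1_line[OF sm[OF s(3) that], of 3 "(x, y, u, p, q)" 0 "p + 1" p] that by simp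
    from this[of 0] this[of 2] show "pd1 2 c z = 0"
      using c_eq[of x y u p q 0 0] c_eq[of x y u "p + 1" q 0 0] by (simp add: z algebra_simps)
  qed
  then have c0: "pd1 0 c = (\<lambda>z. 0)"
    using c_eq[of _ _ _ _ _ 0 0] by (auto simp: fun_eq_iff)
  have m0: "m \<noteq> 0" using m by auto
  have a_eq: "a = (\<lambda>z. (1 / m) * pd1 1 c z + (- (1 + m * real k) / m) * pd1 0 b z)"
  proof
    fix z :: j1pt
    obtain x y u p q where z: "z = (x, y, u, p, q)" by (cases z)
    have "pd1 1 c z - pd1 0 b z = m * (a z + real k * pd1 0 b z)"
      using det(5)[of z 0 0 0]
      by (simp only: z Dx[OF s(2)] Dy[OF s(3)] lift1_jet2 b34 b2 c34 c2 mult_zero_right add_0_right)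
    then show "a z = (1 / m) * pd1 1 c z + (- (1 + m * real k) / m) * pd1 0 b z"
      using m0 by (simp add: field_simps)
  qed
  have five: "i = 0 \<or> i = 1 \<or> i = 2 \<or> i = 3 \<or> i = 4" if "i < 5" for i :: nat using that by linarith
  have dbx: "pd1 i (pd1 0 b) = (\<lambda>z. 0)" if "i < 5" "i \<noteq> 0" for i
  proof -
    have "pd1 i b = (\<lambda>z. 0)" using five[OF that(1)] that(2) b1 b2 b34 by metis
    then show ?thesis using com[OF s(2), of i 0] that by simp
  qed
  have dcy: "pd1 i (pd1 1 c) = (\<lambda>z. 0)" if "i < 5" "i \<noteq> 1" for i
  proof -
    have "pd1 i c = (\<lambda>z. 0)" using five[OF that(1)] that(2) c0 c2 c34 by metis
    then show ?thesis using com[OF s(3), of i 1] that by simp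
  qed
  have da: "pd1 i a = (\<lambda>z. (1 / m) * pd1 i (pd1 1 c) z + (- (1 + m * real k) / m) * pd1 i (pd1 0 b) z)" if "i < 5" for i
    by (subst a_eq, rule pd1_lincomb) (use that s sm in auto)
  \<comment> \<open>The coordinate u_{k-1,0} has order below \<open>k\<close>: varying it keeps the
    coordinates of order at least \<open>k\<close> zero, so an identity on such jets may be
    differentiated.\<close>
  have stay: "pdd (DU (k - 1) 0) F (jet2 z 0 0 0) = 0"
    if "\<And>P. (\<And>i j. i + j \<ge> k \<Longrightarrow> jU P i j = 0) \<Longrightarrow> F P = 0" for F z
  proof -
    have "F (jupd (DU (k - 1) 0) t (jet2 z 0 0 0)) = 0" for t
      by (rule that) (use k high[of _ _ z 0 0 0] in \<open>auto simp: jU_jupd simp del: jupd.simps\<close>)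
    then show ?thesis by (simp add: pdd_def)
  qed
  note det' = determining_equations[OF f k m sym, folded abc]
  have lift_zero: "lift1 (\<lambda>z. 0) = (\<lambda>P. 0)" by (simp add: fun_eq_iff lift1_def)
  have DxDxb: "totDx k (lift1 b) = lift1 (pd1 0 b)" "totDx k (lift1 (pd1 0 b)) = lift1 (pd1 0 (pd1 0 b))"
    "totDy k (lift1 b) = (\<lambda>P. 0)"
    using k by (auto simp: fun_eq_iff totDx_lift1 totDy_lift1 s sm b34 b2 b1[unfolded One_nat_def] dbx lift_zero)
  have bxx: "pd1 0 (pd1 0 b) = (\<lambda>z. 0)"
  proof
    fix z
    have a2: "totDx k (lift1 a) (jet2 z 0 0 0) = (- (1 + m * real k) / m) * pd1 0 (pd1 0 b) z"
      using k by (simp add: totDx_lift1 s lift1_jet2 da dbx dcy[unfolded One_nat_def])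
    have "pdd (DU (k - 1) 0) ((totDx k ^^ k) (lift1 f)) (jet2 z 0 0 0) = 0"
      by (rule stay) (rule det'(1))
    then have "real k * ((- (1 + m * real k) / m) * pd1 0 (pd1 0 b) z)
       + real k * (real k - 1) / 2 * pd1 0 (pd1 0 b) z = 0"
      unfolding DXk_coeffs(2)[OF f k] abc[symmetric] DxDxb a2 lift1_jet2 .
    \<comment> \<open>Multiplying by \<open>2 * m\<close> exposes a factor affine in
      \<open>m\<close> with rational coefficients.\<close>
    moreover have "real k * X * ((- real k - 1) * m - 2)
      = 2 * m * (real k * ((- (1 + m * real k) / m) * X) + real k * (real k - 1) / 2 * X)" for X
      using m0 by (simp add: field_simps)
    ultimately have "real k * pd1 0 (pd1 0 b) z * ((- real k - 1) * m - 2) = 0"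
      by (simp only: mult_zero_right)
    moreover have "(- real k - 1) * m + (- 2) \<noteq> 0"
      by (rule irrational_affine_nonzero[OF m]) auto
    ultimately show "pd1 0 (pd1 0 b) z = 0" using k by simp
  qed
  have cyy: "pd1 1 (pd1 1 c) = (\<lambda>z. 0)"
  proof
    fix z
    have a2: "totDy k (lift1 a) (jet2 z 0 0 0) = (1 / m) * pd1 1 (pd1 1 c) z"
      using k by (simp add: totDy_lift1 s lift1_jet2 da dbx dcy[unfolded One_nat_def])
    have "pdd (DU (k - 1) 0) ((totDx k ^^ (k - 1)) (totDy k (lift1 f))) (jet2 z 0 0 0) = 0"
      by (rule stay) (rule det'(2))
    then have "(1 / m) * pd1 1 (pd1 1 c) z = 0"
      \<comment> \<open>Here D_y b = 0, so only D_y a = c_yy / m is left.\<close>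
      unfolding DXDY_coeffs(2)[OF f k] abc[symmetric] DxDxb a2 by simp
    then show "pd1 1 (pd1 1 c) z = 0" using m0 by simp
  qed
  define \<alpha> \<beta> \<delta> where "\<alpha> = a (0, 0, 0, 0, 0)" and "\<beta> = pd1 0 b (0, 0, 0, 0, 0)" and "\<delta> = pd1 1 c (0, 0, 0, 0, 0)"
  have "pd1 0 b (x, y, u, p, q) = \<beta>" for x y u p q
    unfolding \<beta>_def using affine_if_constant_pd1[OF sm[OF s(2)], of 0 "\<lambda>_. 0"] dbx bxx by fastforce
  then have bx: "pd1 0 b = (\<lambda>z. \<beta>)" by auto
  have "pd1 1 c (x, y, u, p, q) = \<delta>" for x y u p q
    unfolding \<delta>_def using affine_if_constant_pd1[OF sm[OF s(3)], of 1 "\<lambda>_. 0"] dcy cyy by fastforce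
  then have cy: "pd1 1 c = (\<lambda>z. \<delta>)" by auto
  have ae: "a = (\<lambda>z. \<alpha>)"
    unfolding \<alpha>_def by (rule ext, subst (1 2) a_eq) (simp add: bx cy[unfolded One_nat_def])
  have bi: "pd1 i b = (\<lambda>z. if i = 0 then \<beta> else 0)" if "i < 5" for i
    using five[OF that] bx b1 b2 b34 by (elim disjE) simp_all
  have ci: "pd1 i c = (\<lambda>z. if i = 1 then \<delta> else 0)" if "i < 5" for i
    using five[OF that] cy c0 c2 c34 by (elim disjE) simp_all
  define B C where "B = b (0, 0, 0, 0, 0)" and "C = c (0, 0, 0, 0, 0)"
  have b: "b (x, y, u, p, q) = B + \<beta> * x"
    and c: "c (x, y, u, p, q) = C + \<delta> * y" for x y u p q
    using affine_if_constant_pd1[OF s(2) bi, of x y u p q] affine_if_constant_pd1[OF s(3) ci, of x y u p q]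
    by (simp_all add: B_def C_def)
  show ?thesis
  proof (rule that)
    have "\<alpha> = (1 / m) * \<delta> + (- (1 + m * real k) / m) * \<beta>"
      unfolding \<alpha>_def by (subst a_eq) (simp add: bx cy[unfolded One_nat_def])
    then show "\<delta> - \<beta> = m * (\<alpha> + real k * \<beta>)" using m0 by (simp add: field_simps)
    fix x y u p q
    show "f (x, y, u, p, q) = f (x, y, 0, 0, 0) + \<alpha> * u + (B + \<beta> * x) * p + (C + \<delta> * y) * q"
      using constant_pd1_line[OF f, of 2 "(x, y, u, 0, 0)" \<alpha> u 0]
        constant_pd1_line[OF f, of 3 "(x, y, u, p, 0)" "B + \<beta> * x" p 0]
        constant_pd1_line[OF f, of 4 "(x, y, u, p, q)" "C + \<delta> * y" q 0]
      by (simp add: abc[symmetric] ae b c)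
  qed
qed

section \<open>Generating functions affine in the fibre coordinates\<close>

text \<open>An abstract family \<open>h\<close>, standing for the derivatives of
  \<open>h 0 0\<close>, lets the formulas serve both for a given symmetry and for explicit
  polynomials. The y-derivatives are taken in row 0 because D_y acts before D_x.\<close>

context
  fixes k :: nat and h :: "nat \<Rightarrow> nat \<Rightarrow> real \<Rightarrow> real \<Rightarrow> real" and \<alpha> \<beta> \<delta> A B :: real
  assumes hx: "\<And>i j x y. ((\<lambda>x. h i j x y) has_real_derivative h (Suc i) j x y) (at x)"
    and hy: "\<And>j x y. ((\<lambda>y. h 0 j x y) has_real_derivative h 0 (Suc j) x y) (at y)"
begin

text \<open>Closed form of D_x^i D_y^j f for affine f. Each D_x adds \<open>\<beta>\<close> and each
  D_y adds \<open>\<delta>\<close> to the weight of u_{ij}; the last two terms are exactly those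
  subtracted in \<open>prol_U\<close>.\<close>

definition iter_prol :: "nat \<Rightarrow> nat \<Rightarrow> jetpt \<Rightarrow> real" where
  "iter_prol i j P = h i j (jx P) (jy P) + (\<alpha> + real i * \<beta> + real j * \<delta>) * jU P i j
     + (A + \<beta> * jx P) * jU P (Suc i) j + (B + \<delta> * jy P) * jU P i (Suc j)"

lemma pdd_iter_prol:
  "pdd DX (iter_prol i j) P = h (Suc i) j (jx P) (jy P) + \<beta> * jU P (Suc i) j"
  "pdd DY (iter_prol 0 j) P = h 0 (Suc j) (jx P) (jy P) + \<delta> * jU P 0 (Suc j)"
  "pdd (DU a b) (iter_prol i j) P = (if a = i \<and> b = j then \<alpha> + real i * \<beta> + real j * \<delta>
     else if a = Suc i \<and> b = j then A + \<beta> * jx P else if a = i \<and> b = Suc j then B + \<delta> * jy P else 0)"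
proof -
  show "pdd DX (iter_prol i j) P = h (Suc i) j (jx P) (jy P) + \<beta> * jU P (Suc i) j"
    unfolding pdd_def
    by (rule DERIV_imp_deriv) (auto simp: iter_prol_def intro!: derivative_eq_intros hx)
  show "pdd DY (iter_prol 0 j) P = h 0 (Suc j) (jx P) (jy P) + \<delta> * jU P 0 (Suc j)"
    unfolding pdd_def
    by (rule DERIV_imp_deriv) (auto simp: iter_prol_def intro!: derivative_eq_intros hy)
  have "jx (jupd (DU a b) t P) = jx P" "jy (jupd (DU a b) t P) = jy P" for t by simp_all
  then have eq: "iter_prol i j (jupd (DU a b) t P) = h i j (jx P) (jy P)
     + (\<alpha> + real i * \<beta> + real j * \<delta>) * (if a = i \<and> b = j then t else jU P i j)
     + (A + \<beta> * jx P) * (if a = Suc i \<and> b = j then t else jU P (Suc i) j)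
     + (B + \<delta> * jy P) * (if a = i \<and> b = Suc j then t else jU P i (Suc j))" for t
    by (simp only: iter_prol_def jU_jupd dir.inject)
  show "pdd (DU a b) (iter_prol i j) P = (if a = i \<and> b = j then \<alpha> + real i * \<beta> + real j * \<delta>
     else if a = Suc i \<and> b = j then A + \<beta> * jx P else if a = i \<and> b = Suc j then B + \<delta> * jy P else 0)"
    unfolding pdd_def eq
    by (rule DERIV_imp_deriv) (auto intro!: derivative_eq_intros)
qed

lemma totDx_iter_prol:
  assumes "i + j < k"
  shows "totDx k (iter_prol i j) = iter_prol (Suc i) j"
proof
  fix P
  have "(\<Sum>c\<in>{(a, b). a + b \<le> k}. jU P (Suc (fst c)) (snd c) * pdd (DU (fst c) (snd c)) (iter_prol i j) P)
     = (\<Sum>c\<in>{(i, j), (Suc i, j), (i, Suc j)}. jU P (Suc (fst c)) (snd c) * pdd (DU (fst c) (snd c)) (iter_prol i j) P)"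
    \<comment> \<open>The bound \<open>i + j < k\<close> keeps all three coordinates inside the
      truncated sum.\<close>
    using assms by (intro sum.mono_neutral_right finite_order_le) (auto simp: pdd_iter_prol)
  then show "totDx k (iter_prol i j) P = iter_prol (Suc i) j P"
    by (simp add: totDx_eq pdd_iter_prol) (simp add: iter_prol_def algebra_simps)
qed

lemma totDy_iter_prol:
  assumes "j < k"
  shows "totDy k (iter_prol 0 j) = iter_prol 0 (Suc j)"
proof
  fix P
  have "(\<Sum>c\<in>{(a, b). a + b \<le> k}. jU P (fst c) (Suc (snd c)) * pdd (DU (fst c) (snd c)) (iter_prol 0 j) P)
     = (\<Sum>c\<in>{(0, j), (Suc 0, j), (0, Suc j)}. jU P (fst c) (Suc (snd c)) * pdd (DU (fst c) (snd c)) (iter_prol 0 j) P)"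
    using assms by (intro sum.mono_neutral_right finite_order_le) (auto simp: pdd_iter_prol)
  then show "totDy k (iter_prol 0 j) P = iter_prol 0 (Suc j) P"
    by (simp add: totDy_eq pdd_iter_prol) (simp add: iter_prol_def algebra_simps)
qed

lemma prol_U_affine:
  assumes f: "\<And>x y u p q. f (x, y, u, p, q) = h 0 0 x y + \<alpha> * u + (A + \<beta> * x) * p + (B + \<delta> * y) * q"
    and ij: "i + j \<le> k"
  shows "prol_U k f i j P = h i j (jx P) (jy P) + (\<alpha> + real i * \<beta> + real j * \<delta>) * jU P i j"
proof -
  have f0: "lift1 f = iter_prol 0 0"
    by (simp add: fun_eq_iff lift1_def iter_prol_def f)
  have "j \<le> k \<Longrightarrow> (totDy k ^^ j) (lift1 f) = iter_prol 0 j" for j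
    by (induction j) (simp_all add: f0 totDy_iter_prol)
  moreover have "i + j \<le> k \<Longrightarrow> (totDx k ^^ i) (iter_prol 0 j) = iter_prol i j" for i
    by (induction i) (simp_all add: totDx_iter_prol)
  ultimately have "(totDx k ^^ i) ((totDy k ^^ j) (lift1 f)) = iter_prol i j"
    using ij by simp
  then show ?thesis
    by (simp add: prol_U_def pdU_eq f0 pdd_iter_prol) (simp add: iter_prol_def)
qed

text \<open>By \<open>rel\<close> the weight of u_{k-i,i} is
  \<open>(\<alpha> + k * \<beta>) * (i * m + 1)\<close>, so the prolonged field rescales the
  parameter at rate \<open>\<alpha> + k * \<beta>\<close> and preserves the system.\<close>

lemma contact_symmetry_affine:
  assumes f: "\<And>x y u p q. f (x, y, u, p, q) = h 0 0 x y + \<alpha> * u + (A + \<beta> * x) * p + (B + \<delta> * y) * q"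
    and smooth: "smooth_j1 f" and m: "m \<notin> \<rat>" and rel: "\<delta> - \<beta> = m * (\<alpha> + real k * \<beta>)"
    and h0: "\<And>i x y. i \<le> k \<Longrightarrow> h (k - i) i x y = 0"
  shows "contact_symmetry k (sysF k m) f"
  unfolding contact_symmetry_def
proof (intro conjI smooth ballI)
  fix P assume "P \<in> sysF k m"
  then obtain l where l: "l > 0" "\<And>i. i \<le> k \<Longrightarrow> jU P (k - i) i = l powr (real i * m + 1) / (real i * m + 1)"
    by (auto simp: sysF_def)
  have m0: "real i * m + 1 \<noteq> 0" for i by (rule irrational_affine_nonzero[OF m]) auto
  show "tangent_to k (sysF k m) P (prol_x f P) (prol_y f P) (\<lambda>i j. prol_U k f i j P)"
  proof (rule tangent_sysFI[OF l(2,1) m0])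
    fix i assume i: "i \<le> k"
    have "\<alpha> + real (k - i) * \<beta> + real i * \<delta> = (\<alpha> + real k * \<beta>) + real i * (\<delta> - \<beta>)"
      using i by (simp add: of_nat_diff algebra_simps)
    also have "\<dots> = (\<alpha> + real k * \<beta>) * (real i * m + 1)"
      unfolding rel by (simp add: algebra_simps)
    finally have "prol_U k f (k - i) i P = (\<alpha> + real k * \<beta>) * (real i * m + 1) * jU P (k - i) i"
      using i prol_U_affine[OF f, of "k - i" i P] by (simp add: h0)
    also have "\<dots> = (\<alpha> + real k * \<beta>) * l powr (real i * m + 1)"
      using l(2)[OF i] m0[of i] by simp
    also have "\<dots> = l powr (real i * m) * ((\<alpha> + real k * \<beta>) * l)"
      using l(1) by (simp add: powr_add)
    finally show "prol_U k f (k - i) i P = l powr (real i * m) * ((\<alpha> + real k * \<beta>) * l)" .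
  qed
qed

text \<open>The weighted terms are already tangent, so what remains is h_{k-i,i} = lam^(im) h_{k,0}
  for every positive lam, with derivatives of \<open>h\<close> independent of lam. Comparing lam = 1
  and lam = 2 at \<open>i = 1\<close> gives h_{k,0} = 0.\<close>

lemma symmetry_top_derivatives_zero:
  assumes f: "\<And>x y u p q. f (x, y, u, p, q) = h 0 0 x y + \<alpha> * u + (A + \<beta> * x) * p + (B + \<delta> * y) * q"
    and m: "m \<notin> \<rat>" and rel: "\<delta> - \<beta> = m * (\<alpha> + real k * \<beta>)"
    and sym: "contact_symmetry k (sysF k m) f" and k: "k > 0" and i: "i \<le> k"
  shows "h (k - i) i x y = 0"
proof -
  have m0: "real i * m + 1 \<noteq> 0" for i by (rule irrational_affine_nonzero[OF m]) auto
  have eq: "h (k - i) i x y = l powr (real i * m) * h k 0 x y" if l: "l > 0" and i: "i \<le> k" for l i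
  proof -
    define P :: jetpt where "P = (x, y, \<lambda>a b. if a + b = k then l powr (real b * m + 1) / (real b * m + 1) else 0)"
    have PU: "jU P (k - i) i = l powr (real i * m + 1) / (real i * m + 1)" if "i \<le> k" for i
      using that by (simp add: P_def)
    then have "P \<in> sysF k m" using l by (auto simp: sysF_def)
    then have "tangent_to k (sysF k m) P (prol_x f P) (prol_y f P) (\<lambda>i j. prol_U k f i j P)"
      using sym by (simp add: contact_symmetry_def)
    from tangent_sysF_imp[OF this PU l m0 i]
    have "prol_U k f (k - i) i P = l powr (real i * m) * prol_U k f k 0 P" by simp
    moreover have "prol_U k f (k - i) i P = h (k - i) i x y + (\<alpha> + real k * \<beta>) * l powr (real i * m + 1)" if i: "i \<le> k" for i
    proof -
      have "\<alpha> + real (k - i) * \<beta> + real i * \<delta> = (\<alpha> + real k * \<beta>) + real i * (\<delta> - \<beta>)"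
        using i by (simp add: of_nat_diff algebra_simps)
      also have "\<dots> = (\<alpha> + real k * \<beta>) * (real i * m + 1)"
        unfolding rel by (simp add: algebra_simps)
      finally show ?thesis using i prol_U_affine[OF f, of "k - i" i P] m0[of i] PU[OF i] by (simp add: P_def)
    qed
    from this[OF i] this[of 0] have "prol_U k f (k - i) i P = h (k - i) i x y + (\<alpha> + real k * \<beta>) * l powr (real i * m + 1)"
      "prol_U k f k 0 P = h k 0 x y + (\<alpha> + real k * \<beta>) * l" using l by simp_all
    ultimately show ?thesis using l by (simp add: powr_add algebra_simps)
  qed
  have "2 powr m * h k 0 x y = h k 0 x y"
    using eq[of 1 1] eq[of 2 1] k by simp
  moreover have "2 powr m \<noteq> 1" using m by (auto simp: powr_def)
  ultimately have "h k 0 x y = 0" by simp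
  then show ?thesis using eq[of 1 i] i by simp
qed

text \<open>Expansion in \<open>y\<close> to degree \<open>k\<close>, then of each coefficient in
  \<open>x\<close> to degree \<open>k - j\<close>; every remainder contains a derivative of total
  order \<open>k\<close> and vanishes.\<close>

lemma bivariate_Maclaurin:
  assumes h0: "\<And>i x y. i \<le> k \<Longrightarrow> h (k - i) i x y = 0"
  shows "h 0 0 x y = (\<Sum>(i, j)\<in>{(i, j). i + j < k}. h i j 0 0 / (fact i * fact j) * x ^ i * y ^ j)"
proof -
  have Y: "h 0 0 x y = (\<Sum>j<k. h 0 j x 0 / fact j * y ^ j)"
    using Maclaurin_all_le[of "\<lambda>j y. h 0 j x y" "h 0 0 x" y k] hy h0[of k] by auto
  have X: "h 0 j x 0 = (\<Sum>i<k - j. h i j 0 0 / fact i * x ^ i)" if "j < k" for j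
    using Maclaurin_all_le[of "\<lambda>i x. h i j x 0" "\<lambda>x. h 0 j x 0" x "k - j"] hx h0[of j] that by auto
  have "h 0 0 x y = (\<Sum>j<k. \<Sum>i<k - j. h i j 0 0 / (fact i * fact j) * x ^ i * y ^ j)"
    unfolding Y by (intro sum.cong refl) (simp add: X sum_divide_distrib sum_distrib_left sum_distrib_right mult_ac)
  also have "\<dots> = (\<Sum>(j, i)\<in>(SIGMA j:{..<k}. {..<k - j}). h i j 0 0 / (fact i * fact j) * x ^ i * y ^ j)"
    by (subst sum.Sigma) auto
  also have "\<dots> = (\<Sum>(i, j)\<in>{(i, j). i + j < k}. h i j 0 0 / (fact i * fact j) * x ^ i * y ^ j)"
    by (rule sum.reindex_bij_witness[of _ prod.swap prod.swap]) auto
  finally show ?thesis .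
qed

end

section \<open>Slices of smooth functions and smoothness of polynomials\<close>

lemma smooth_slice_derivatives:
  assumes "smooth_j1 f"
  shows "((\<lambda>x. ((pd1 0 ^^ i) ((pd1 1 ^^ j) f)) (x, y, 0, 0, 0)) has_real_derivative
      ((pd1 0 ^^ Suc i) ((pd1 1 ^^ j) f)) (x, y, 0, 0, 0)) (at x)"
    and "((\<lambda>y. ((pd1 1 ^^ j) f) (x, y, 0, 0, 0)) has_real_derivative ((pd1 1 ^^ Suc j) f) (x, y, 0, 0, 0)) (at y)"
proof -
  have 1: "smooth_j1 ((pd1 1 ^^ j) f)" for j
    by (induction j) (simp_all add: assms smooth_j1_pd1)
  have 0: "smooth_j1 ((pd1 0 ^^ i) ((pd1 1 ^^ j) f))" for i j
    by (induction i) (simp_all add: 1[unfolded One_nat_def] smooth_j1_pd1)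
  show "((\<lambda>x. ((pd1 0 ^^ i) ((pd1 1 ^^ j) f)) (x, y, 0, 0, 0)) has_real_derivative
      ((pd1 0 ^^ Suc i) ((pd1 1 ^^ j) f)) (x, y, 0, 0, 0)) (at x)"
    using has_derivative_pd1[OF 0, of 0 i j "(x, y, 0, 0, 0)"] by simp
  show "((\<lambda>y. ((pd1 1 ^^ j) f) (x, y, 0, 0, 0)) has_real_derivative ((pd1 1 ^^ Suc j) f) (x, y, 0, 0, 0)) (at y)"
    using has_derivative_pd1[OF 1, of 1 j "(x, y, 0, 0, 0)"] by simp
qed

inductive j1_polynomial :: "(j1pt \<Rightarrow> real) \<Rightarrow> bool" where
  j1_polynomial_const: "j1_polynomial (\<lambda>z. c)"
| j1_polynomial_coord1: "j1_polynomial (coord1 i)"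
| j1_polynomial_add: "j1_polynomial g \<Longrightarrow> j1_polynomial h \<Longrightarrow> j1_polynomial (\<lambda>z. g z + h z)"
| j1_polynomial_mult: "j1_polynomial g \<Longrightarrow> j1_polynomial h \<Longrightarrow> j1_polynomial (\<lambda>z. g z * h z)"

text \<open>The polynomials themselves form the family of continuous functions closed under partial
  derivatives.\<close>

lemma smooth_j1_polynomial:
  assumes "j1_polynomial g"
  shows "smooth_j1 g"
proof -
  have cont: "continuous_on UNIV g" if "j1_polynomial g" for g
    using that
  proof induction
    case (j1_polynomial_coord1 i)
    have "coord1 i = (\<lambda>z. if i = 0 then fst z else if i = 1 then fst (snd z) else if i = 2 then fst (snd (snd z))
       else if i = 3 then fst (snd (snd (snd z))) else snd (snd (snd (snd z))))"
      by auto
    then show ?case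
      by (cases "i = 0"; cases "i = 1"; cases "i = 2"; cases "i = 3"; auto intro!: continuous_intros)
  qed (auto intro!: continuous_intros)
  have der: "\<exists>g'. j1_polynomial g' \<and> (\<forall>z. ((\<lambda>t. g (upd1 i t z)) has_real_derivative g' z) (at (coord1 i z)))"
    if "j1_polynomial g" "i < 5" for g i
    using that(1)
  proof induction
    case (j1_polynomial_const c)
    then show ?case by (intro exI[of _ "\<lambda>z. 0"]) (auto intro: j1_polynomial.intros)
  next
    case (j1_polynomial_coord1 j)
    \<comment> \<open>All indices from 4 on denote the last coordinate, hence the
      \<open>min\<close>.\<close>
    have *: "coord1 j (upd1 i t z) = (if min i 4 = min j 4 then t else coord1 j z)" for t z
      using that(2) by (cases z) auto
    show ?case
      by (intro exI[of _ "\<lambda>z. if min i 4 = min j 4 then 1 else 0"])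
        (auto simp: * intro: j1_polynomial.intros)
  next
    case (j1_polynomial_add g h)
    then obtain g' h' where "j1_polynomial g'" "j1_polynomial h'"
      "\<And>z. ((\<lambda>t. g (upd1 i t z)) has_real_derivative g' z) (at (coord1 i z))"
      "\<And>z. ((\<lambda>t. h (upd1 i t z)) has_real_derivative h' z) (at (coord1 i z))" by blast
    then show ?case
      by (intro exI[of _ "\<lambda>z. g' z + h' z"]) (auto intro!: derivative_intros j1_polynomial.intros)
  next
    case (j1_polynomial_mult g h)
    then obtain g' h' where "j1_polynomial g'" "j1_polynomial h'"
      and d: "\<And>z. ((\<lambda>t. g (upd1 i t z)) has_real_derivative g' z) (at (coord1 i z))"
      "\<And>z. ((\<lambda>t. h (upd1 i t z)) has_real_derivative h' z) (at (coord1 i z))" by blast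
    with j1_polynomial_mult.hyps have "j1_polynomial (\<lambda>z. g' z * h z + h' z * g z)"
      by (auto intro!: j1_polynomial.intros)
    moreover have "((\<lambda>t. g (upd1 i t z) * h (upd1 i t z)) has_real_derivative g' z * h z + h' z * g z) (at (coord1 i z))" for z
      using DERIV_mult[OF d[of z]] that(2) by (simp add: upd1_coord1)
    ultimately show ?case by blast
  qed
  show ?thesis
    unfolding smooth_j1_def
    by (rule exI[of _ "Collect j1_polynomial"]) (use assms cont der in blast)
qed

lemma j1_polynomial_power: "j1_polynomial g \<Longrightarrow> j1_polynomial (\<lambda>z. g z ^ n)"
  by (induction n) (auto intro: j1_polynomial.intros)

lemma j1_polynomial_sum:
  "finite T \<Longrightarrow> (\<And>x. x \<in> T \<Longrightarrow> j1_polynomial (g x)) \<Longrightarrow> j1_polynomial (\<lambda>z. \<Sum>x\<in>T. g x z)"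
  by (induction rule: finite_induct) (auto intro: j1_polynomial.intros)

section \<open>The asserted basis\<close>

text \<open>Indexing the asserted basis makes its size and coefficients computable on a plain index
  set; injectivity transfers the results to \<open>sym_basis\<close>.\<close>

fun sym_gen :: "nat \<Rightarrow> real \<Rightarrow> (nat \<times> nat) + nat \<Rightarrow> j1pt \<Rightarrow> real" where
  "sym_gen k m (Inl (i, j)) = (\<lambda>(x, y, u, p, q). x ^ i * y ^ j)"
| "sym_gen k m (Inr n) =
    (if n = 0 then (\<lambda>(x, y, u, p, q). p)
     else if n = 1 then (\<lambda>(x, y, u, p, q). q)
     else if n = 2 then (\<lambda>(x, y, u, p, q). (real k * m + 1) * u - m * x * p)
     else (\<lambda>(x, y, u, p, q). u + m * y * q))"

definition sym_index :: "nat \<Rightarrow> ((nat \<times> nat) + nat) set" where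
  "sym_index k = {(i, j). i + j < k} <+> {..<4}"

lemma finite_order_less: "finite {(i, j). i + j < (k :: nat)}"
  by (rule finite_subset[of _ "{..k} \<times> {..k}"]) auto

lemma finite_sym_index: "finite (sym_index k)"
  unfolding sym_index_def by (intro finite_Plus finite_order_less finite_lessThan)

lemma card_order_less: "card {(i, j). i + j < (k :: nat)} = k * (k + 1) div 2"
proof -
  have "{(i, j). i + j < k} = (SIGMA i:{..<k}. {..<k - i})" by auto
  then have "card {(i, j). i + j < k} = (\<Sum>i<k. k - i)" by simp
  also have "\<dots> = (\<Sum>i<k. Suc i)"
    by (rule sum.reindex_bij_witness[of _ "\<lambda>i. k - Suc i" "\<lambda>i. k - Suc i"]) auto
  also have "\<dots> = k * (k + 1) div 2"
    by (induction k) auto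
  finally show ?thesis .
qed

lemma card_sym_index: "card (sym_index k) = k * (k + 1) div 2 + 4"
  unfolding sym_index_def by (subst card_Plus) (auto simp: finite_order_less card_order_less)

lemma sym_basis_eq: "sym_basis k m = sym_gen k m ` sym_index k"
proof -
  have gen: "{g i j | i j. i + j < k} = case_prod g ` {(i, j). i + j < k}" for g :: "nat \<Rightarrow> nat \<Rightarrow> j1pt \<Rightarrow> real"
    by auto
  have "sym_gen k m ` Inl ` {(i, j). i + j < k} = {(\<lambda>(x, y, u, p, q). x ^ i * y ^ j) | i j. i + j < k}"
    unfolding gen image_image by (intro image_cong) auto
  moreover have "sym_gen k m ` Inr ` {..<4} = {(\<lambda>(x, y, u, p, q). p), (\<lambda>(x, y, u, p, q). q),
      (\<lambda>(x, y, u, p, q). (real k * m + 1) * u - m * x * p), (\<lambda>(x, y, u, p, q). u + m * y * q)}"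
    by (simp add: eval_nat_numeral lessThan_Suc insert_commute)
  ultimately show ?thesis by (simp only: sym_basis_def sym_index_def Plus_def image_Un)
qed

text \<open>Puts a combination into the affine normal form, from which \<open>\<alpha>\<close>,
  \<open>\<beta>\<close>, \<open>\<delta>\<close>, \<open>A\<close> and \<open>B\<close> can be read
  off.\<close>

lemma sum_sym_gen:
  "(\<Sum>n\<in>sym_index k. d n * sym_gen k m n (x, y, u, p, q)) =
     (\<Sum>(i, j)\<in>{(i, j). i + j < k}. d (Inl (i, j)) * x ^ i * y ^ j)
     + (d (Inr 2) * (real k * m + 1) + d (Inr 3)) * u
     + (d (Inr 0) + - m * d (Inr 2) * x) * p + (d (Inr 1) + m * d (Inr 3) * y) * q"
proof -
  have "sym_gen k m (Inl c) (x, y, u, p, q) = x ^ fst c * y ^ snd c" for c by (cases c) simp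
  then show ?thesis
    unfolding sym_index_def sum.Plus[OF finite_order_less finite_lessThan]
    by (simp add: eval_nat_numeral case_prod_beta algebra_simps)
qed

text \<open>Padding the coefficients by zeros to a square allows the one-variable identity theorem
  in \<open>x\<close>, then in \<open>y\<close>.\<close>

lemma bivariate_polynomial_eq_0:
  fixes c :: "nat \<Rightarrow> nat \<Rightarrow> real"
  assumes 0: "\<And>x y. (\<Sum>(i, j)\<in>{(i, j). i + j < k}. c i j * x ^ i * y ^ j) = 0" and ij: "i + j < k"
  shows "c i j = 0"
proof -
  define c' where "c' i j = (if i + j < k then c i j else 0)" for i j
  have "(\<Sum>i\<le>k. (\<Sum>j\<le>k. c' i j * y ^ j) * x ^ i) = 0" for x y
  proof -
    have "(\<Sum>i\<le>k. (\<Sum>j\<le>k. c' i j * y ^ j) * x ^ i) = (\<Sum>(i, j)\<in>{..k} \<times> {..k}. c' i j * x ^ i * y ^ j)"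
      by (simp add: sum.cartesian_product[symmetric] sum_distrib_left sum_distrib_right mult_ac)
    also have "\<dots> = (\<Sum>(i, j)\<in>{(i, j). i + j < k}. c i j * x ^ i * y ^ j)"
      by (rule sum.mono_neutral_cong_right) (auto simp: c'_def split: if_splits)
    finally show ?thesis using 0 by simp
  qed
  then have "(\<Sum>j\<le>k. c' i j * y ^ j) = 0" for y
    using ij polyfun_eq_0[of "\<lambda>i. \<Sum>j\<le>k. c' i j * y ^ j" k] by auto
  then have "c' i j = 0"
    using ij polyfun_eq_0[of "c' i" k] by auto
  then show ?thesis using ij by (simp add: c'_def)
qed

text \<open>Setting the fibre coordinates to 0 isolates the polynomial part; the other coefficients
  follow by evaluation at a few points, two of them after division by \<open>m\<close>.\<close>

lemma sym_gen_independent: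
  assumes m: "m \<noteq> 0" and 0: "\<And>z. (\<Sum>n\<in>sym_index k. d n * sym_gen k m n z) = 0" and n: "n \<in> sym_index k"
  shows "d n = 0"
proof -
  let ?S = "\<lambda>x y. \<Sum>(i, j)\<in>{(i, j). i + j < k}. d (Inl (i, j)) * x ^ i * y ^ j"
  note eq = 0[of "(_, _, _, _, _)", unfolded sum_sym_gen]
  have S: "?S x y = 0" for x y using eq[of x y 0 0 0] by simp
  have "d (Inr 0) = 0" using eq[of 0 0 0 1 0] S[of 0 0] by simp
  moreover have "d (Inr 1) = 0" using eq[of 0 0 0 0 1] S[of 0 0] by simp
  moreover have "m * d (Inr 2) = 0" using eq[of 1 0 0 1 0] S[of 1 0] \<open>d (Inr 0) = 0\<close> by simp
  moreover have "m * d (Inr 3) = 0" using eq[of 0 1 0 0 1] S[of 0 1] \<open>d (Inr 1) = 0\<close> by simp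
  ultimately have "d (Inr i) = 0" if "i < 4" for i
    using that m by (auto simp: eval_nat_numeral less_Suc_eq)
  moreover have "d (Inl (i, j)) = 0" if "i + j < k" for i j
    using bivariate_polynomial_eq_0[OF S that] .
  ultimately show ?thesis using n by (auto simp: sym_index_def)
qed

lemma inj_on_sym_gen:
  assumes m: "m \<noteq> 0"
  shows "inj_on (sym_gen k m) (sym_index k)"
proof (rule inj_onI, rule ccontr)
  fix a b assume ab: "a \<in> sym_index k" "b \<in> sym_index k" "sym_gen k m a = sym_gen k m b" "a \<noteq> b"
  \<comment> \<open>Two indices with the same function would give a nontrivial vanishing
    combination.\<close>
  let ?d = "\<lambda>n. (if n = a then 1 else 0) - (if n = b then 1 else 0) :: real"
  have "(\<Sum>n\<in>sym_index k. ?d n * sym_gen k m n z) = 0" for z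
  proof -
    have "(\<Sum>n\<in>sym_index k. ?d n * sym_gen k m n z) =
      (\<Sum>n\<in>sym_index k. if n = a then sym_gen k m n z else 0) - (\<Sum>n\<in>sym_index k. if n = b then sym_gen k m n z else 0)"
      unfolding sum_subtractf[symmetric] by (intro sum.cong refl) auto
    then show ?thesis using ab finite_sym_index[of k] by (simp add: sum.delta')
  qed
  then have "?d a = 0" by (rule sym_gen_independent[OF m]) (rule ab)
  then show False using ab by simp
qed

lemma sym_span_contact_symmetry:
  assumes m: "m \<notin> \<rat>" and k: "k > 0"
  shows "contact_symmetry k (sysF k m) (\<lambda>z. \<Sum>n\<in>sym_index k. d n * sym_gen k m n z)"
proof -
  let ?T = "{(i, j). i + j < k}"
  \<comment> \<open>The derivative of order \<open>i\<close> of the monomial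
    \<open>x ^ n\<close>.\<close>
  define mono :: "nat \<Rightarrow> nat \<Rightarrow> real \<Rightarrow> real"
    where "mono n i x = (if i \<le> n then fact n / fact (n - i) * x ^ (n - i) else 0)" for n i x
  have mono: "((\<lambda>x. mono n i x) has_real_derivative mono n (Suc i) x) (at x)" for n i x
  proof (cases "Suc i \<le> n")
    case True
    then obtain l where "n = i + Suc l" by (metis add_Suc_right le_Suc_ex plus_nat.simps(2))
    then have n: "i \<le> n" "n - i = Suc l" "n - Suc i = l" by auto
    have "((\<lambda>x. fact n / fact (Suc l) * x ^ Suc l) has_real_derivative fact n / fact (Suc l) * (real (Suc l) * x ^ l)) (at x)"
      using DERIV_cmult[OF DERIV_pow[of "Suc l" x], of "fact n / fact (Suc l)"] by simp
    moreover have "fact n / fact (Suc l) * (real (Suc l) * x ^ l) = fact n / fact l * x ^ l"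
      by (simp del: of_nat_Suc)
    ultimately show ?thesis using True n by (simp add: mono_def)
  next
    case False
    then show ?thesis by (cases "i = n") (auto simp: mono_def)
  qed
  define h where "h i j x y = (\<Sum>c\<in>?T. d (Inl c) * mono (fst c) i x * mono (snd c) j y)" for i j x y
  show ?thesis
  proof (rule contact_symmetry_affine[where h = h and \<alpha> = "d (Inr 2) * (real k * m + 1) + d (Inr 3)"
        and \<beta> = "- m * d (Inr 2)" and \<delta> = "m * d (Inr 3)" and A = "d (Inr 0)" and B = "d (Inr 1)"])
    show "((\<lambda>x. h i j x y) has_real_derivative h (Suc i) j x y) (at x)" for i j x y
      unfolding h_def by (auto intro!: derivative_eq_intros mono sum.cong)
    show "((\<lambda>y. h 0 j x y) has_real_derivative h 0 (Suc j) x y) (at y)" for j x y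
      unfolding h_def by (auto intro!: derivative_eq_intros mono sum.cong)
    show "(\<Sum>n\<in>sym_index k. d n * sym_gen k m n (x, y, u, p, q)) = h 0 0 x y
        + (d (Inr 2) * (real k * m + 1) + d (Inr 3)) * u
        + (d (Inr 0) + - m * d (Inr 2) * x) * p + (d (Inr 1) + m * d (Inr 3) * y) * q" for x y u p q
      unfolding sum_sym_gen by (simp add: h_def mono_def case_prod_beta)
    have "j1_polynomial (sym_gen k m n)" for n
    proof -
      have eqs: "(\<lambda>(x, y, u, p, q). x ^ i * y ^ j) = (\<lambda>z. coord1 0 z ^ i * coord1 1 z ^ j)"
        "(\<lambda>(x, y, u, p, q). p) = coord1 3" "(\<lambda>(x, y, u, p, q). q) = coord1 4"
        "(\<lambda>(x, y, u, p, q). (real k * m + 1) * u - m * x * p) =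
           (\<lambda>z. (real k * m + 1) * coord1 2 z + (- m) * coord1 0 z * coord1 3 z)"
        "(\<lambda>(x, y, u, p, q). u + m * y * q) = (\<lambda>z. coord1 2 z + m * coord1 1 z * coord1 4 z)" for i j
        by auto
      show ?thesis
      proof (cases n)
        case (Inl c)
        then show ?thesis
          by (cases c) (auto simp only: Inl sym_gen.simps eqs intro!: j1_polynomial.intros j1_polynomial_power)
      next
        case (Inr l)
        then show ?thesis
          by (auto simp only: Inr sym_gen.simps eqs split: if_split intro!: j1_polynomial.intros)
      qed
    qed
    then show "smooth_j1 (\<lambda>z. \<Sum>n\<in>sym_index k. d n * sym_gen k m n z)"
      by (intro smooth_j1_polynomial j1_polynomial_sum finite_sym_index j1_polynomial_mult j1_polynomial_const)
    show "m * d (Inr 3) - - m * d (Inr 2) = m * (d (Inr 2) * (real k * m + 1) + d (Inr 3) + real k * (- m * d (Inr 2)))"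
      by (simp add: algebra_simps)
    show "h (k - i) i x y = 0" if "i \<le> k" for i x y
      \<comment> \<open>A monomial of total degree below \<open>k\<close> has x-degree below
        \<open>k - i\<close> or y-degree below \<open>i\<close>.\<close>
      unfolding h_def using that by (intro sum.neutral) (auto simp: mono_def)
  qed (rule m)
qed

lemma contact_symmetry_sym_span:
  assumes k: "k > 2" and m: "m \<notin> \<rat>" and sym: "contact_symmetry k (sysF k m) f"
  obtains d where "f = (\<lambda>z. \<Sum>n\<in>sym_index k. d n * sym_gen k m n z)"
proof -
  have f: "smooth_j1 f" using sym by (simp add: contact_symmetry_def)
  have m0: "m \<noteq> 0" using m by auto
  obtain \<alpha> \<beta> \<delta> A B where rel: "\<delta> - \<beta> = m * (\<alpha> + real k * \<beta>)"
    and aff: "\<And>x y u p q. f (x, y, u, p, q) = f (x, y, 0, 0, 0) + \<alpha> * u + (A + \<beta> * x) * p + (B + \<delta> * y) * q"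
    using symmetry_affine_form[OF k m sym] by metis
  define h where "h i j x y = ((pd1 0 ^^ i) ((pd1 1 ^^ j) f)) (x, y, 0, 0, 0)" for i j x y
  have hx: "((\<lambda>x. h i j x y) has_real_derivative h (Suc i) j x y) (at x)"
    and hy: "((\<lambda>y. h 0 j x y) has_real_derivative h 0 (Suc j) x y) (at y)" for i j x y
    unfolding h_def using smooth_slice_derivatives[OF f] by simp_all
  have aff': "f (x, y, u, p, q) = h 0 0 x y + \<alpha> * u + (A + \<beta> * x) * p + (B + \<delta> * y) * q" for x y u p q
    using aff[of x y u p q] by (simp add: h_def)
  have h0: "h (k - i) i x y = 0" if "i \<le> k" for i x y
    by (rule symmetry_top_derivatives_zero[OF hx hy aff' m rel sym _ that]) (use k in simp)
  \<comment> \<open>Taylor coefficients for the polynomial part; the rest inverts the identification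
    in \<open>sum_sym_gen\<close>, where the coefficient of \<open>u\<close> comes out as
    \<open>\<alpha>\<close> because of \<open>rel\<close>.\<close>
  define d :: "(nat \<times> nat) + nat \<Rightarrow> real" where
    "d n = (case n of Inl (i, j) \<Rightarrow> h i j 0 0 / (fact i * fact j)
       | Inr l \<Rightarrow> if l = 0 then A else if l = 1 then B else if l = 2 then - \<beta> / m else \<delta> / m)" for n
  have "f (x, y, u, p, q) = (\<Sum>n\<in>sym_index k. d n * sym_gen k m n (x, y, u, p, q))" for x y u p q
  proof -
    have "d (Inr 2) * (real k * m + 1) + d (Inr 3) = \<alpha>"
      using rel m0 by (simp add: d_def field_simps)
    moreover have "h 0 0 x y = (\<Sum>(i, j)\<in>{(i, j). i + j < k}. d (Inl (i, j)) * x ^ i * y ^ j)"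
      using bivariate_Maclaurin[OF hx hy h0, of x y] by (simp add: d_def)
    ultimately show ?thesis
      unfolding sum_sym_gen aff' using m0 by (simp add: d_def)
  qed
  then show ?thesis by (intro that[of d]) (auto simp: fun_eq_iff)
qed

theorem theorem4:
  fixes k :: nat
  assumes "k > 2"
  shows "\<exists>E :: real set. countable E \<and>
           (\<forall>m. m \<notin> E \<longrightarrow>
              finite (sym_basis k m) \<and>
              card (sym_basis k m) = k * (k + 1) div 2 + 4 \<and>
              (\<forall>c :: (j1pt \<Rightarrow> real) \<Rightarrow> real.
                  (\<forall>z. (\<Sum>b\<in>sym_basis k m. c b * b z) = 0) \<longrightarrow> (\<forall>b\<in>sym_basis k m. c b = 0)) \<and>
              {f. contact_symmetry k (sysF k m) f} =
                {(\<lambda>z. \<Sum>b\<in>sym_basis k m. c b * b z) | c. True})"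
proof (intro exI[of _ \<rat>] conjI allI impI)
  show "countable (\<rat> :: real set)" by (rule countable_rat)
  fix m :: real
  assume m: "m \<notin> \<rat>"
  then have m0: "m \<noteq> 0" by auto
  note inj = inj_on_sym_gen[OF m0, of k]
  have sum_eq: "(\<Sum>b\<in>sym_basis k m. c b * b z) = (\<Sum>n\<in>sym_index k. c (sym_gen k m n) * sym_gen k m n z)" for c z
    by (simp add: sym_basis_eq sum.reindex[OF inj])
  show "finite (sym_basis k m)"
    by (simp add: sym_basis_eq finite_sym_index)
  show "card (sym_basis k m) = k * (k + 1) div 2 + 4"
    by (simp add: sym_basis_eq card_image[OF inj] card_sym_index)
  show "\<forall>b\<in>sym_basis k m. c b = 0" if "\<forall>z. (\<Sum>b\<in>sym_basis k m. c b * b z) = 0" for c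
    using sym_gen_independent[OF m0, where k = k and d = "\<lambda>n. c (sym_gen k m n)"] that
    unfolding sum_eq by (auto simp: sym_basis_eq)
  show "{f. contact_symmetry k (sysF k m) f} = {(\<lambda>z. \<Sum>b\<in>sym_basis k m. c b * b z) | c. True}"
  proof (intro equalityI subsetI)
    fix f assume "f \<in> {f. contact_symmetry k (sysF k m) f}"
    then obtain d where f: "f = (\<lambda>z. \<Sum>n\<in>sym_index k. d n * sym_gen k m n z)"
      using contact_symmetry_sym_span[OF assms m] by blast
    \<comment> \<open>Injectivity lets coefficients on indices be read as coefficients on basis
      functions.\<close>
    have "f = (\<lambda>z. \<Sum>b\<in>sym_basis k m. d (inv_into (sym_index k) (sym_gen k m) b) * b z)"
      unfolding f sum_eq by (intro ext sum.cong refl) (simp add: inv_into_f_f[OF inj])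
    then show "f \<in> {(\<lambda>z. \<Sum>b\<in>sym_basis k m. c b * b z) | c. True}"
      by (intro CollectI exI[of _ "\<lambda>b. d (inv_into (sym_index k) (sym_gen k m) b)"]) simp
  next
    fix f assume "f \<in> {(\<lambda>z. \<Sum>b\<in>sym_basis k m. c b * b z) | c. True}"
    then obtain c where f: "f = (\<lambda>z. \<Sum>b\<in>sym_basis k m. c b * b z)" by blast
    show "f \<in> {f. contact_symmetry k (sysF k m) f}"
      unfolding f sum_eq using sym_span_contact_symmetry[OF m] assms by simp
  qed
qed

end
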